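(* Let $p>3$ be a prime and, for $n\in\mathbb{N}$, let $A_n=\sum_{k=0}^n\binom{n}{k}^2\binom{n+k}{k}^2$ be the Apéry numbers. Then $$\frac1p\sum_{k=0}^{p-1}(-1)^k(2k+1)A_k\equiv \left(\frac{p}{3}\right)+\frac{p^2}{6}B_{p-2}\left(\frac13\right)\pmod{p^3}.$$
   Context: $\left(\frac{\cdot}{3}\right)$ denotes the Legendre symbol. $B_n(x)=\sum_{k=0}^n\binom nk B_k x^{n-k}$ is the $n$th Bernoulli polynomial, where $B_k$ are the Bernoulli numbers. Congruences between rational numbers are understood in the ring of rationals whose denominators are coprime to $p$: $a\equiv b\pmod{p^m}$ means $(a-b)/p^m$ is such a rational. *)

theory Defs
  imports Complex_Main "HOL-Number_Theory.Number_Theory"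
begin

text \<open>Bernoulli numbers (convention B_1 = -1/2), defined by the standard recursion
  sum_{k=0}^{n} binom(n+1,k) B_k = 0 for n >= 1, B_0 = 1.\<close>
fun bernoulli_num :: "nat \<Rightarrow> rat" where
  "bernoulli_num n =
     (if n = 0 then 1
      else - (\<Sum>k<n. of_nat (Suc n choose k) * bernoulli_num k) / of_nat (Suc n))"

declare bernoulli_num.simps [simp del]

definition bernoulli_poly :: "nat \<Rightarrow> rat \<Rightarrow> rat" where
  "bernoulli_poly n x = (\<Sum>k\<le>n. of_nat (n choose k) * bernoulli_num k * x ^ (n - k))"

definition apery :: "nat \<Rightarrow> nat" where
  "apery n = (\<Sum>k\<le>n. (n choose k)^2 * ((n + k) choose k)^2)"

text \<open>Congruence of rationals modulo p^m: (a - b)/p^m has denominator coprime to p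
  (quotient_of gives the reduced representation with positive denominator).\<close>
definition rat_cong :: "rat \<Rightarrow> rat \<Rightarrow> int \<Rightarrow> nat \<Rightarrow> bool" where
  "rat_cong a b p m = coprime (snd (quotient_of ((a - b) / (of_int p) ^ m))) p"

end

theory Submission
  imports Defs "HOL-Computational_Algebra.Formal_Power_Series"
begin

text \<open>
  Put \<open>P(r,m) = binom(r,m) binom(r+m,m)\<close>, so that \<open>A_r\<close> is the sum of the \<open>P(r,m)^2\<close>.  The
  alternating sums of \<open>(2r+1) P(r,m)^2\<close> over \<open>r < p\<close>, divided by \<open>p binom(2m,m)\<close>, have differences
  in closed form as \<open>m\<close> varies, so summation by parts expresses the left-hand side through the
  partial sums of the central binomial coefficients.  Since \<open>1 + w = - w^2\<close> for a primitive cube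
  root of unity \<open>w\<close>, those partial sums are equal to \<open>sum_k (k/3) binom(2n,n+k)\<close>, and a second
  telescoping reduces the left-hand side modulo \<open>p^3\<close> to \<open>(p/3) - Y\<close> with
  \<open>Y = sum_{0<k<p} (k/3) binom(p,k)/binom(p+k,k)\<close>.

  The product \<open>binom(p-1,k) binom(p+k,k)\<close> is \<open>(-1)^k\<close> times the product of the \<open>1 - p^2/t^2\<close> over
  \<open>t \<le> k\<close>.  Hence \<open>binom(p,k)/binom(p+k,k)\<close> is congruent to \<open>(-1)^k binom(p,k) binom(p-1,k)\<close>
  modulo \<open>p^3\<close>, and because \<open>binom(p-1,k)\<close> is \<open>(-1)^k\<close> modulo \<open>p\<close> the product
  \<open>binom(p-1,k-1) binom(p-1,k)\<close> linearizes modulo \<open>p^2\<close>.  With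
  \<open>T_r = sum_{0<k<p} (-1)^(k-1) (k/3)/k^r\<close>, the evaluation of \<open>sum_k binom(n,k) (k/3)/k\<close> for
  \<open>n = p-1\<close> and \<open>n = p\<close> gives \<open>Y = -2 p T_1\<close> modulo \<open>p^3\<close> and \<open>T_1 = p T_2\<close> modulo \<open>p^2\<close>.

  The reflection \<open>k -> p-k\<close> expresses \<open>T_2\<close> modulo \<open>p\<close> through the sum of \<open>(-1)^k/k^2\<close> over the
  multiples \<open>k < p\<close> of 3 and then through the sum of \<open>1/k^2\<close> over \<open>k < p/3\<close>, which is a value
  of a Bernoulli polynomial by the theorems of Fermat and Faulhaber.
\<close>

section \<open>Congruences between rational numbers\<close>

locale localization =
  fixes p :: nat
begin

definition p_integers :: "rat set" where
  "p_integers = {x. coprime (snd (quotient_of x)) (int p)}"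

lemma p_integers_iff:
  "x \<in> p_integers \<longleftrightarrow> (\<exists>a b. b \<noteq> 0 \<and> coprime b (int p) \<and> x = of_int a / of_int b)"
proof
  assume "x \<in> p_integers"
  moreover have "x = of_int (fst (quotient_of x)) / of_int (snd (quotient_of x))"
    by (rule quotient_of_div) simp
  moreover have "snd (quotient_of x) \<noteq> 0"
    using quotient_of_denom_pos'[of x] by simp
  ultimately show "\<exists>a b. b \<noteq> 0 \<and> coprime b (int p) \<and> x = of_int a / of_int b"
    unfolding p_integers_def by blast
next
  assume "\<exists>a b. b \<noteq> 0 \<and> coprime b (int p) \<and> x = of_int a / of_int b"
  then obtain a b where ab: "b \<noteq> 0" "coprime b (int p)" "x = of_int a / of_int b"
    by blast
  obtain c d where cd: "quotient_of x = (c, d)"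
    by fastforce
  then have "d > 0" "coprime c d" "x = of_int c / of_int d"
    by (auto dest: quotient_of_denom_pos quotient_of_coprime quotient_of_div)
  with ab have "of_int (a * d) = (of_int (c * b) :: rat)"
    by (simp add: field_simps)
  then have "d dvd c * b"
    unfolding of_int_eq_iff by (metis dvd_triv_right)
  with \<open>coprime c d\<close> have "d dvd b"
    by (simp add: coprime_commute coprime_dvd_mult_right_iff)
  with ab(2) show "x \<in> p_integers"
    using coprime_divisors[of d b "int p" "int p"] by (simp add: p_integers_def cd)
qed

lemma p_integers_of_int [simp]: "of_int a \<in> p_integers"
  by (simp add: p_integers_def)

lemma p_integers_of_nat [simp]: "of_nat a \<in> p_integers"
  using p_integers_of_int[of "int a"] by simp

lemma p_integers_numeral [simp]: "numeral a \<in> p_integers"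
  using p_integers_of_int[of "numeral a"] by simp

lemma p_integers_0 [simp]: "0 \<in> p_integers"
  using p_integers_of_int[of 0] by simp

lemma p_integers_1 [simp]: "1 \<in> p_integers"
  using p_integers_of_int[of 1] by simp

lemma p_integers_add [intro]:
  assumes "x \<in> p_integers" "y \<in> p_integers"
  shows "x + y \<in> p_integers"
proof -
  obtain a b c d where "b \<noteq> 0" "coprime b (int p)" "x = of_int a / of_int b"
      and "d \<noteq> 0" "coprime d (int p)" "y = of_int c / of_int d"
    using assms unfolding p_integers_iff by blast
  then have "b * d \<noteq> 0 \<and> coprime (b * d) (int p) \<and> x + y = of_int (a * d + c * b) / of_int (b * d)"
    by (simp add: field_simps)
  then show ?thesis
    unfolding p_integers_iff by blast
qed

lemma p_integers_mult [intro]: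
  assumes "x \<in> p_integers" "y \<in> p_integers"
  shows "x * y \<in> p_integers"
proof -
  obtain a b c d where "b \<noteq> 0" "coprime b (int p)" "x = of_int a / of_int b"
      and "d \<noteq> 0" "coprime d (int p)" "y = of_int c / of_int d"
    using assms unfolding p_integers_iff by blast
  then have "b * d \<noteq> 0 \<and> coprime (b * d) (int p) \<and> x * y = of_int (a * c) / of_int (b * d)"
    by simp
  then show ?thesis
    unfolding p_integers_iff by blast
qed

lemma p_integers_uminus [intro]: "x \<in> p_integers \<Longrightarrow> - x \<in> p_integers"
  using p_integers_mult[OF p_integers_of_int[of "-1"]] by simp

lemma p_integers_diff [intro]:
  "x \<in> p_integers \<Longrightarrow> y \<in> p_integers \<Longrightarrow> x - y \<in> p_integers"
  using p_integers_add[of x "- y"] p_integers_uminus[of y] by simp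

lemma p_integers_power [intro]: "x \<in> p_integers \<Longrightarrow> x ^ n \<in> p_integers"
  by (induction n) auto

lemma p_integers_sum [intro]:
  "(\<And>k. k \<in> A \<Longrightarrow> f k \<in> p_integers) \<Longrightarrow> sum f A \<in> p_integers"
  by (induction A rule: infinite_finite_induct) auto

lemma p_integers_inverse:
  assumes "coprime k p"
  shows "1 / of_nat k \<in> p_integers"
proof (cases "k = 0")
  case False
  then have "int k \<noteq> 0" "coprime (int k) (int p)"
    and "1 / of_nat k = (of_int 1 / of_int (int k) :: rat)"
    using assms by simp_all
  then show ?thesis
    unfolding p_integers_iff by blast
qed simp

lemma p_integers_minus_1_power [simp]: "(-1) ^ k \<in> p_integers"
  by (intro p_integers_power p_integers_uminus p_integers_1)

definition pcong :: "rat \<Rightarrow> nat \<Rightarrow> rat \<Rightarrow> bool" ("(_ \<equiv>\<^bsub>_\<^esub> _)" [51, 0, 51] 50) where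
  "x \<equiv>\<^bsub>m\<^esub> y \<longleftrightarrow> (x - y) / of_nat p ^ m \<in> p_integers"

lemma rat_cong_iff_pcong: "rat_cong x y (int p) m \<longleftrightarrow> x \<equiv>\<^bsub>m\<^esub> y"
  by (simp add: rat_cong_def pcong_def p_integers_def)

lemma pcong_refl [simp]: "x \<equiv>\<^bsub>m\<^esub> x"
  by (simp add: pcong_def)

lemma pcong_sym: "x \<equiv>\<^bsub>m\<^esub> y \<Longrightarrow> y \<equiv>\<^bsub>m\<^esub> x"
  unfolding pcong_def by (metis p_integers_uminus minus_diff_eq minus_divide_left)

lemma pcong_add:
  "x \<equiv>\<^bsub>m\<^esub> y \<Longrightarrow> z \<equiv>\<^bsub>m\<^esub> w \<Longrightarrow> x + z \<equiv>\<^bsub>m\<^esub> y + w"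
  unfolding pcong_def by (metis p_integers_add add_diff_add add_divide_distrib)

lemma pcong_diff:
  "x \<equiv>\<^bsub>m\<^esub> y \<Longrightarrow> z \<equiv>\<^bsub>m\<^esub> w \<Longrightarrow> x - z \<equiv>\<^bsub>m\<^esub> y - w"
  using pcong_add[of x m y "- z" "- w"] pcong_sym[of z m w] by (simp add: pcong_def)

lemma pcong_uminus: "x \<equiv>\<^bsub>m\<^esub> y \<Longrightarrow> - x \<equiv>\<^bsub>m\<^esub> - y"
  using pcong_diff[of 0 m 0 x y] by simp

lemma pcong_trans [trans]:
  "x \<equiv>\<^bsub>m\<^esub> y \<Longrightarrow> y \<equiv>\<^bsub>m\<^esub> z \<Longrightarrow> x \<equiv>\<^bsub>m\<^esub> z"
  using pcong_add[of x m y y z] by (simp add: pcong_def)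

(* Instances of forw_subst and back_subst, whose higher-order unification is slow on large sums. *)
lemma pcong_eq_trans [trans]: "x \<equiv>\<^bsub>m\<^esub> y \<Longrightarrow> y = z \<Longrightarrow> x \<equiv>\<^bsub>m\<^esub> z"
  and eq_pcong_trans [trans]: "x = y \<Longrightarrow> y \<equiv>\<^bsub>m\<^esub> z \<Longrightarrow> x \<equiv>\<^bsub>m\<^esub> z"
  by simp_all

lemma pcong_sum:
  "(\<And>k. k \<in> A \<Longrightarrow> f k \<equiv>\<^bsub>m\<^esub> g k) \<Longrightarrow> sum f A \<equiv>\<^bsub>m\<^esub> sum g A"
  by (induction A rule: infinite_finite_induct) (auto intro: pcong_add)

lemma pcong_mult_left:
  "c \<in> p_integers \<Longrightarrow> x \<equiv>\<^bsub>m\<^esub> y \<Longrightarrow> c * x \<equiv>\<^bsub>m\<^esub> c * y"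
  unfolding pcong_def by (metis p_integers_mult right_diff_distrib times_divide_eq_right)

lemma pcong_mult:
  assumes "x \<equiv>\<^bsub>m\<^esub> y" "z \<equiv>\<^bsub>m\<^esub> w" "x \<in> p_integers" "w \<in> p_integers"
  shows "x * z \<equiv>\<^bsub>m\<^esub> y * w"
proof -
  have "x * z \<equiv>\<^bsub>m\<^esub> x * w"
    using assms by (intro pcong_mult_left)
  also have "\<dots> \<equiv>\<^bsub>m\<^esub> y * w"
    using assms pcong_mult_left[of w x m y] by (simp add: mult.commute)
  finally show ?thesis .
qed

lemma pcong_power:
  assumes "x \<equiv>\<^bsub>m\<^esub> y" "x \<in> p_integers" "y \<in> p_integers"
  shows "x ^ n \<equiv>\<^bsub>m\<^esub> y ^ n"
  using assms by (induction n) (auto intro!: pcong_mult)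

lemma pcong_mult_raise:
  assumes "a \<equiv>\<^bsub>m\<^esub> 0" "x \<equiv>\<^bsub>n\<^esub> y" "l = m + n"
  shows "a * x \<equiv>\<^bsub>l\<^esub> a * y"
proof -
  have "(a * x - a * y) / of_nat p ^ l = a / of_nat p ^ m * ((x - y) / of_nat p ^ n)"
    by (simp add: \<open>l = m + n\<close> power_add flip: right_diff_distrib)
  also have "\<dots> \<in> p_integers"
    using assms unfolding pcong_def by (intro p_integers_mult) simp_all
  finally show ?thesis
    unfolding pcong_def .
qed

lemma pcong_power_0: "of_nat p ^ m \<equiv>\<^bsub>m\<^esub> 0"
  unfolding pcong_def by (simp add: divide_self_if del: power_eq_0_iff)

lemma pcong_power_mult_0:
  assumes "c \<in> p_integers"
  shows "of_nat p ^ m * c \<equiv>\<^bsub>m\<^esub> 0"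
  using pcong_mult_left[OF assms pcong_power_0] by (simp add: mult.commute)

lemma pcong_of_nat:
  assumes "[a = b] (mod p ^ m)"
  shows "of_nat a \<equiv>\<^bsub>m\<^esub> of_nat b"
proof -
  have "[int a = int b] (mod int p ^ m)"
    using assms by (simp flip: cong_int_iff of_nat_power)
  then obtain q where "int a - int b = int p ^ m * q"
    unfolding cong_iff_dvd_diff by blast
  then have "of_int (int a - int b) = (of_int (int p ^ m * q) :: rat)"
    by (simp only:)
  moreover have "of_nat p ^ m * of_int q \<equiv>\<^bsub>m\<^esub> 0"
    by (intro pcong_power_mult_0 p_integers_of_int)
  ultimately show ?thesis
    by (simp add: pcong_def)
qed

lemma pcong_power_mult_left:
  "x \<equiv>\<^bsub>n\<^esub> y \<Longrightarrow> l = m + n \<Longrightarrow> of_nat p ^ m * x \<equiv>\<^bsub>l\<^esub> of_nat p ^ m * y"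
  by (rule pcong_mult_raise[OF pcong_power_0])

lemma pcong_mono:
  assumes "x \<equiv>\<^bsub>n\<^esub> y" "m \<le> n" "p \<noteq> 0"
  shows "x \<equiv>\<^bsub>m\<^esub> y"
proof -
  have "of_nat p ^ n = (of_nat p ^ m * of_nat p ^ (n - m) :: rat)"
    using \<open>m \<le> n\<close> by (simp flip: power_add)
  then have "(x - y) / of_nat p ^ m = of_nat p ^ (n - m) * ((x - y) / of_nat p ^ n)"
    using \<open>p \<noteq> 0\<close> by simp
  then show ?thesis
    using assms(1) unfolding pcong_def by (metis p_integers_mult p_integers_of_nat of_nat_power)
qed

lemma pcong_cancel:
  assumes "c * x \<equiv>\<^bsub>m\<^esub> c * y" "1 / c \<in> p_integers" "c \<noteq> 0"
  shows "x \<equiv>\<^bsub>m\<^esub> y"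
  using pcong_mult_left[OF assms(2,1)] assms(3) by simp

end

section \<open>Bernoulli polynomials\<close>

definition bernoulli_fps :: "rat fps" where
  "bernoulli_fps = Abs_fps (\<lambda>n. bernoulli_num n / fact n)"

lemma sum_choose_bernoulli:
  "(\<Sum>k<n. of_nat (n choose k) * bernoulli_num k) = of_bool (n = 1)"
proof -
  consider (zero) "n = 0" | (one) "n = 1" | (Suc) m where "n = Suc m" "m > 0"
    by (cases n) auto
  then show ?thesis
  proof cases
    case (Suc m)
    have "bernoulli_num m = - (\<Sum>k<m. of_nat (Suc m choose k) * bernoulli_num k) / of_nat (Suc m)"
      using \<open>m > 0\<close> by (subst bernoulli_num.simps) simp
    then have "of_nat (Suc m) * bernoulli_num m
        = - (\<Sum>k<m. of_nat (Suc m choose k) * bernoulli_num k)"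
      by (simp add: field_simps del: of_nat_Suc binomial_Suc_Suc)
    then show ?thesis
      using Suc by simp
  qed (simp_all add: bernoulli_num.simps[of 0])
qed

lemma bernoulli_fps_times_exp:
  "bernoulli_fps * fps_exp x = Abs_fps (\<lambda>n. bernoulli_poly n x / fact n)"
proof (rule fps_ext)
  fix n
  have "bernoulli_num k / fact k * (x ^ (n - k) / fact (n - k))
      = of_nat (n choose k) * bernoulli_num k * x ^ (n - k) / fact n" if "k \<le> n" for k
    using that by (simp add: binomial_fact)
  then show "fps_nth (bernoulli_fps * fps_exp x) n
      = fps_nth (Abs_fps (\<lambda>n. bernoulli_poly n x / fact n)) n"
    by (simp add: fps_mult_nth bernoulli_fps_def bernoulli_poly_def sum_divide_distrib
        flip: atMost_atLeast0)
qed

lemma bernoulli_fps_times_exp_minus_1: "bernoulli_fps * (fps_exp 1 - 1) = fps_X"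
proof (rule fps_ext)
  fix n
  have "fps_nth (bernoulli_fps * (fps_exp 1 - 1)) n
      = (bernoulli_poly n 1 - bernoulli_num n) / fact n"
    by (simp only: right_diff_distrib bernoulli_fps_times_exp)
      (simp add: bernoulli_fps_def diff_divide_distrib)
  also have "bernoulli_poly n 1 - bernoulli_num n = (\<Sum>k<n. of_nat (n choose k) * bernoulli_num k)"
    by (simp add: bernoulli_poly_def flip: lessThan_Suc_atMost)
  finally show "fps_nth (bernoulli_fps * (fps_exp 1 - 1)) n = fps_nth fps_X n"
    by (simp add: sum_choose_bernoulli fps_X_def)
qed

lemma bernoulli_poly_0: "bernoulli_poly n 0 = bernoulli_num n"
  using fun_cong[OF arg_cong[OF bernoulli_fps_times_exp[of 0], of fps_nth], of n]
  by (simp add: bernoulli_fps_def)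

lemma bernoulli_poly_add_1:
  "bernoulli_poly n (x + 1) = bernoulli_poly n x + of_nat n * x ^ (n - 1)"
proof -
  have "bernoulli_fps * fps_exp (x + 1)
      = bernoulli_fps * fps_exp x + bernoulli_fps * (fps_exp 1 - 1) * fps_exp x"
    by (simp add: fps_exp_add_mult algebra_simps)
  then have "bernoulli_poly n (x + 1) / fact n
      = bernoulli_poly n x / fact n + (if n = 0 then 0 else x ^ (n - 1) / fact (n - 1))"
    unfolding bernoulli_fps_times_exp_minus_1 bernoulli_fps_times_exp
    by (simp add: fps_eq_iff)
  also have "(if n = 0 then 0 else x ^ (n - 1) / fact (n - 1)) = of_nat n * x ^ (n - 1) / fact n"
    by (cases n) simp_all
  finally show ?thesis
    by (simp flip: add_divide_distrib)
qed

lemma sum_powers_eq_bernoulli_poly: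
  "of_nat n * (\<Sum>k<m. of_nat k ^ (n - 1)) = bernoulli_poly n (of_nat m) - bernoulli_num n"
proof (induction m)
  case (Suc m)
  then show ?case
    using bernoulli_poly_add_1[of n "of_nat m"] by (simp add: algebra_simps)
qed (simp add: bernoulli_poly_0)

lemma bernoulli_fps_compose_uminus: "bernoulli_fps oo - fps_X = bernoulli_fps + fps_X"
proof -
  have "(bernoulli_fps oo - fps_X) * (fps_exp (- 1) - 1) = - fps_X"
    using fps_compose_mult_distrib[of "- fps_X" bernoulli_fps "fps_exp 1 - 1"]
    by (simp add: bernoulli_fps_times_exp_minus_1 fps_compose_sub_distrib)
  then have "(bernoulli_fps oo - fps_X) * ((fps_exp (- 1) - 1) * fps_exp 1) = - fps_X * fps_exp 1"
    by (simp only: mult.assoc[symmetric])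
  also have "(fps_exp (- 1) - 1) * fps_exp 1 = (- (fps_exp 1 - 1) :: rat fps)"
    by (simp add: left_diff_distrib flip: fps_exp_add_mult)
  finally have "(bernoulli_fps oo - fps_X) * (fps_exp 1 - 1) = fps_X * fps_exp 1"
    by (simp only: mult_minus_left mult_minus_right neg_equal_iff_equal)
  also have "\<dots> = (bernoulli_fps + fps_X) * (fps_exp 1 - 1)"
    by (simp only: distrib_right bernoulli_fps_times_exp_minus_1) (simp add: algebra_simps)
  finally show ?thesis
    by simp
qed

lemma bernoulli_num_odd:
  assumes "odd n" "n \<noteq> 1"
  shows "bernoulli_num n = 0"
proof -
  have "fps_nth (bernoulli_fps oo - fps_X) n = fps_nth (bernoulli_fps + fps_X) n"
    by (simp only: bernoulli_fps_compose_uminus)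
  then show ?thesis
    using assms by (simp add: fps_compose_uminus' bernoulli_fps_def)
qed

section \<open>Binomial coefficients and the alternating sum of Apery numbers\<close>

lemma Suc_times_of_nat_choose_Suc:
  "of_nat (Suc k) * of_nat (n choose Suc k) = (of_nat n - of_nat k) * (of_nat (n choose k) :: rat)"
  using gbinomial_mult_1[of "of_nat n :: rat" k] by (simp add: binomial_gbinomial algebra_simps)

lemma Suc_times_of_nat_add_choose_Suc:
  "of_nat (Suc k) * of_nat ((n + Suc k) choose Suc k)
    = (of_nat n + of_nat k + 1) * (of_nat ((n + k) choose k) :: rat)"
  using arg_cong[OF Suc_times_binomial[of k "n + k"], of "of_nat :: nat \<Rightarrow> rat"]
  by (simp add: algebra_simps del: binomial_Suc_Suc)

lemma choose_eq_div_times_choose_pred: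
  assumes "k > 0"
  shows "of_nat (n choose k) = (of_nat n * (1 / of_nat k * of_nat (n - 1 choose (k - 1))) :: rat)"
  using arg_cong[OF times_binomial_minus1_eq[OF assms, of n], of "of_nat :: nat \<Rightarrow> rat"] assms
  by (simp add: field_simps)

definition central_binom :: "nat \<Rightarrow> rat" where
  "central_binom n = of_nat (2 * n choose n)"

lemma central_binom_neq_0 [simp]: "central_binom n \<noteq> 0"
  by (simp add: central_binom_def)

lemma central_binom_Suc:
  "of_nat (Suc n) * central_binom (Suc n) = 2 * (2 * of_nat n + 1) * central_binom n"
proof -
  have "Suc n * (2 * Suc n choose Suc n) = 2 * (Suc n * (Suc (2 * n) choose n))"
    using Suc_times_binomial_eq[of "2 * n + 1" n] by (simp add: algebra_simps)
  also have "Suc n * (Suc (2 * n) choose n) = (2 * n + 1) * (2 * n choose n)"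
    using Suc_times_binomial_add[of n n] Suc_times_binomial[of n "2 * n"] by (simp add: mult_2)
  finally have "of_nat (Suc n * (2 * Suc n choose Suc n))
      = (of_nat (2 * ((2 * n + 1) * (2 * n choose n))) :: rat)"
    by (simp only:)
  then show ?thesis
    unfolding central_binom_def by (simp add: algebra_simps)
qed

definition square_ratio_prod :: "nat \<Rightarrow> nat \<Rightarrow> rat" where
  "square_ratio_prod n j = (\<Prod>t=1..j. 1 - of_nat n ^ 2 / of_nat t ^ 2)"

lemma square_ratio_prod_Suc_eq_binomials:
  "(-1) ^ j * square_ratio_prod (Suc n) j = of_nat (n choose j) * of_nat ((Suc n + j) choose j)"
proof (induction j)
  case (Suc j)
  have "of_nat (Suc j) ^ 2 * ((-1) ^ Suc j * square_ratio_prod (Suc n) (Suc j))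
      = ((of_nat n - of_nat j) * of_nat (n choose j))
        * ((of_nat (Suc n) + of_nat j + 1) * of_nat ((Suc n + j) choose j))"
  proof -
    have "square_ratio_prod (Suc n) (Suc j)
        = square_ratio_prod (Suc n) j * (1 - of_nat (Suc n) ^ 2 / of_nat (Suc j) ^ 2)"
      by (simp add: square_ratio_prod_def)
    then have "of_nat (Suc j) ^ 2 * square_ratio_prod (Suc n) (Suc j)
        = (of_nat (Suc j) ^ 2 - of_nat (Suc n) ^ 2) * square_ratio_prod (Suc n) j"
      by (simp add: right_diff_distrib left_diff_distrib mult.commute del: of_nat_Suc)
    then have "of_nat (Suc j) ^ 2 * ((-1) ^ Suc j * square_ratio_prod (Suc n) (Suc j))
        = (of_nat (Suc n) ^ 2 - of_nat (Suc j) ^ 2) * ((-1) ^ j * square_ratio_prod (Suc n) j)"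
      by (simp only: power_Suc mult.left_commute[of "of_nat (Suc j) ^ 2"]) (simp add: algebra_simps)
    then show ?thesis
      unfolding Suc.IH by (simp add: algebra_simps power2_eq_square)
  qed
  also have "\<dots> = (of_nat (Suc j) * of_nat (n choose Suc j))
      * (of_nat (Suc j) * of_nat ((Suc n + Suc j) choose Suc j))"
    unfolding Suc_times_of_nat_add_choose_Suc unfolding Suc_times_of_nat_choose_Suc ..
  finally have "of_nat (Suc j) ^ 2 * ((-1) ^ Suc j * square_ratio_prod (Suc n) (Suc j))
      = of_nat (Suc j) ^ 2 * (of_nat (n choose Suc j) * of_nat ((Suc n + Suc j) choose Suc j))"
    by (simp only: power2_eq_square mult_ac)
  then show ?case
    by (metis mult_cancel_left of_nat_neq_0 power_not_zero)
qed (simp add: square_ratio_prod_def)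

definition apery_factor :: "nat \<Rightarrow> nat \<Rightarrow> rat" where
  "apery_factor n m = of_nat (n choose m) * of_nat ((n + m) choose m)"

lemma apery_eq_sum_factors:
  assumes "k < n"
  shows "of_nat (apery k) = (\<Sum>m<n. apery_factor k m ^ 2)"
proof -
  have "(\<Sum>m<n. apery_factor k m ^ 2) = (\<Sum>m\<le>k. apery_factor k m ^ 2)"
    by (rule sum.mono_neutral_right) (use assms in \<open>auto simp: apery_factor_def\<close>)
  then show ?thesis
    by (simp add: apery_def apery_factor_def power_mult_distrib)
qed

lemma apery_factor_Suc:
  "of_nat (Suc m) ^ 2 * apery_factor n (Suc m)
    = (of_nat n - of_nat m) * (of_nat n + of_nat m + 1) * apery_factor n m"
proof -
  have "of_nat (Suc m) ^ 2 * apery_factor n (Suc m)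
      = (of_nat (Suc m) * of_nat (n choose Suc m))
        * (of_nat (Suc m) * of_nat ((n + Suc m) choose Suc m))"
    by (simp only: apery_factor_def power2_eq_square mult_ac)
  also have "\<dots> = (of_nat n - of_nat m) * (of_nat n + of_nat m + 1) * apery_factor n m"
    unfolding Suc_times_of_nat_add_choose_Suc unfolding Suc_times_of_nat_choose_Suc
    by (simp only: apery_factor_def mult_ac)
  finally show ?thesis .
qed

lemma square_ratio_prod_Suc_left:
  "of_nat (Suc n) * ((-1) ^ j * square_ratio_prod (Suc n) j)
    = (of_nat n + of_nat j + 1) * apery_factor n j"
proof -
  have "of_nat (Suc n) * of_nat ((Suc n + j) choose j)
      = (of_nat n + of_nat j + 1) * (of_nat ((n + j) choose j) :: rat)"
    using arg_cong[OF binomial_absorb_comp[of "Suc (n + j)" j], of "of_nat :: nat \<Rightarrow> rat"]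
    by (simp add: algebra_simps)
  then show ?thesis
    unfolding square_ratio_prod_Suc_eq_binomials apery_factor_def by (metis mult.left_commute)
qed

lemma square_ratio_prod_eq_apery_factor:
  "of_nat n * ((-1) ^ j * square_ratio_prod n j) = (of_nat n - of_nat j) * apery_factor n j"
proof (cases n)
  case (Suc l)
  have "of_nat (Suc l) * of_nat (l choose j)
      = (of_nat (Suc l) - of_nat j) * (of_nat (Suc l choose j) :: rat)"
    using gbinomial_absorb_comp[of "of_nat (Suc l) :: rat" j] by (simp add: binomial_gbinomial)
  then show ?thesis
    unfolding Suc square_ratio_prod_Suc_eq_binomials apery_factor_def
    by (simp only: mult.assoc[symmetric])
qed (cases j; simp add: apery_factor_def)

lemma central_binom_eq_square_ratio_prod:
  "central_binom (Suc n) = 2 * ((-1) ^ n * square_ratio_prod (Suc n) n)"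
proof -
  have "of_nat (Suc n) * central_binom (Suc n) = 2 * ((of_nat n + of_nat n + 1) * apery_factor n n)"
    unfolding central_binom_Suc by (simp add: apery_factor_def central_binom_def flip: mult_2)
  also have "\<dots> = of_nat (Suc n) * (2 * ((-1) ^ n * square_ratio_prod (Suc n) n))"
    unfolding square_ratio_prod_Suc_left[symmetric] by (rule mult.left_commute)
  finally show ?thesis
    by (simp del: of_nat_Suc)
qed

definition factor_sum :: "nat \<Rightarrow> nat \<Rightarrow> rat" where
  "factor_sum m n = (\<Sum>r<n. (-1) ^ r * of_nat (2 * r + 1) * apery_factor r m ^ 2)"

lemma sum_apery_eq_factor_sums:
  "(\<Sum>k<n. (-1) ^ k * of_nat (2 * k + 1) * of_nat (apery k)) = (\<Sum>m<n. factor_sum m n)"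
proof -
  have "(\<Sum>k<n. (-1) ^ k * of_nat (2 * k + 1) * (of_nat (apery k) :: rat))
      = (\<Sum>k<n. \<Sum>m<n. (-1) ^ k * of_nat (2 * k + 1) * apery_factor k m ^ 2)"
    by (intro sum.cong refl) (simp add: apery_eq_sum_factors sum_distrib_left)
  also have "\<dots> = (\<Sum>m<n. factor_sum m n)"
    unfolding factor_sum_def by (rule sum.swap)
  finally show ?thesis .
qed

lemma factor_sum_Suc_left:
  "of_nat (Suc m) ^ 4 * factor_sum (Suc m) n
    = 2 * (2 * of_nat m + 1) * of_nat (Suc m) ^ 3 * factor_sum m n
      + (-1) ^ n * of_nat n ^ 3 * (3 * of_nat (Suc m) ^ 2 - of_nat n ^ 2)
        * square_ratio_prod n m ^ 2"
proof (induction n)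
  case (Suc n)
  define N M P where "N = (of_nat n :: rat)" and "M = (of_nat m :: rat)" and "P = apery_factor n m"
  have Q_left: "N ^ 2 * square_ratio_prod n m ^ 2 = (N - M) ^ 2 * P ^ 2"
    using arg_cong[OF square_ratio_prod_eq_apery_factor[of n m], of "\<lambda>x. x ^ 2"]
    by (simp add: N_def M_def P_def power_mult_distrib flip: power_mult)
  have Q_right: "(N + 1) ^ 2 * square_ratio_prod (Suc n) m ^ 2 = (N + M + 1) ^ 2 * P ^ 2"
    using arg_cong[OF square_ratio_prod_Suc_left[of n m], of "\<lambda>x. x ^ 2"]
    by (simp add: N_def M_def P_def power_mult_distrib add.commute flip: power_mult)
  have P_Suc: "(M + 1) ^ 4 * apery_factor n (Suc m) ^ 2 = (N - M) ^ 2 * (N + M + 1) ^ 2 * P ^ 2"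
    using arg_cong[OF apery_factor_Suc[of m n], of "\<lambda>x. x ^ 2"]
    by (simp add: N_def M_def P_def power_mult_distrib add.commute flip: power_mult)
  have "(M + 1) ^ 4 * factor_sum (Suc m) (Suc n)
        - 2 * (2 * M + 1) * (M + 1) ^ 3 * factor_sum m (Suc n)
      = (-1) ^ n * N * (3 * (M + 1) ^ 2 - N ^ 2) * (N ^ 2 * square_ratio_prod n m ^ 2)
        + (-1) ^ n * (2 * N + 1)
          * ((M + 1) ^ 4 * apery_factor n (Suc m) ^ 2 - 2 * (2 * M + 1) * (M + 1) ^ 3 * P ^ 2)"
    using Suc.IH
    by (simp add: factor_sum_def N_def M_def P_def algebra_simps power3_eq_cube power2_eq_square)
  also have "\<dots> = (-1) ^ n * P ^ 2 * (N * (3 * (M + 1) ^ 2 - N ^ 2) * (N - M) ^ 2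
      + (2 * N + 1) * ((N - M) ^ 2 * (N + M + 1) ^ 2 - 2 * (2 * M + 1) * (M + 1) ^ 3))"
    unfolding Q_left P_Suc by (simp only: algebra_simps)
  also have "\<dots> = (-1) ^ n * P ^ 2 * - ((N + 1) * (3 * (M + 1) ^ 2 - (N + 1) ^ 2) * (N + M + 1) ^ 2)"
    by (rule arg_cong[of _ _ "\<lambda>x. (-1) ^ n * P ^ 2 * x"])
      (simp add: algebra_simps power2_eq_square power3_eq_cube)
  also have "\<dots> = (-1) ^ Suc n * (N + 1) * (3 * (M + 1) ^ 2 - (N + 1) ^ 2)
      * ((N + 1) ^ 2 * square_ratio_prod (Suc n) m ^ 2)"
    unfolding Q_right by simp
  finally show ?case
    by (simp add: N_def M_def diff_eq_eq algebra_simps power2_eq_square power3_eq_cube)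
qed (simp add: factor_sum_def)

definition apery_weight :: "nat \<Rightarrow> nat \<Rightarrow> rat" where
  "apery_weight n i = of_nat n ^ 2 / of_nat i ^ 2 * (3 - of_nat n ^ 2 / of_nat i ^ 2)
    * square_ratio_prod n (i - 1) ^ 2"

lemma factor_sum_ratio_diff:
  "factor_sum m n / central_binom m - factor_sum (Suc m) n / central_binom (Suc m)
    = - ((-1) ^ n * of_nat n * apery_weight n (Suc m)) / central_binom (Suc m)"
proof -
  define M N c where "M = (of_nat (Suc m) :: rat)" and "N = (of_nat n :: rat)"
    and "c = central_binom (Suc m)"
  define D where "D = (-1) ^ n * N * apery_weight n (Suc m)"
  define x where "x = factor_sum m n / central_binom m"
  have "M \<noteq> 0" "c \<noteq> 0"
    by (simp_all add: M_def c_def)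
  have c: "M * c = 2 * (2 * of_nat m + 1) * central_binom m"
    unfolding M_def c_def by (rule central_binom_Suc)
  have "M ^ 4 * factor_sum (Suc m) n = 2 * (2 * of_nat m + 1) * M ^ 3 * factor_sum m n
      + (-1) ^ n * N ^ 3 * (3 * M ^ 2 - N ^ 2) * square_ratio_prod n m ^ 2"
    unfolding M_def N_def by (rule factor_sum_Suc_left)
  also have "2 * (2 * of_nat m + 1) * M ^ 3 * factor_sum m n = M ^ 3 * (M * c) * x"
    unfolding c by (simp add: x_def)
  also have "\<dots> = M ^ 4 * (c * x)"
    by (simp add: power3_eq_cube power4_eq_xxxx)
  also have "(-1) ^ n * N ^ 3 * (3 * M ^ 2 - N ^ 2) * square_ratio_prod n m ^ 2
      = (-1) ^ n * (N ^ 3 * (3 * M ^ 2 - N ^ 2)) * square_ratio_prod n m ^ 2"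
    by (simp only: mult.assoc)
  also have "N ^ 3 * (3 * M ^ 2 - N ^ 2) = M ^ 4 * (N * (N ^ 2 / M ^ 2 * (3 - N ^ 2 / M ^ 2)))"
    using \<open>M \<noteq> 0\<close> by (simp add: field_simps power2_eq_square power3_eq_cube power4_eq_xxxx)
  also have "(-1) ^ n * \<dots> * square_ratio_prod n m ^ 2 = M ^ 4 * D"
    unfolding D_def apery_weight_def M_def N_def diff_Suc_1 by (simp only: mult_ac)
  finally have "factor_sum (Suc m) n = c * x + D"
    using \<open>M \<noteq> 0\<close> by (simp flip: distrib_left)
  then have "x - factor_sum (Suc m) n / c = - D / c"
    using \<open>c \<noteq> 0\<close> by (simp add: field_simps)
  then show ?thesis
    unfolding x_def D_def N_def c_def .
qed

lemma factor_sum_diagonal: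
  "factor_sum n (Suc n) = of_nat (Suc n) * central_binom n * square_ratio_prod (Suc n) n"
proof -
  have "(\<Sum>r<n. (-1) ^ r * of_nat (2 * r + 1) * apery_factor r n ^ 2) = 0"
    by (intro sum.neutral) (simp add: apery_factor_def binomial_eq_0)
  moreover have "apery_factor n n = central_binom n"
    by (simp add: apery_factor_def central_binom_def flip: mult_2)
  ultimately have "factor_sum n (Suc n)
      = (-1) ^ n * ((of_nat n + of_nat n + 1) * apery_factor n n) * central_binom n"
    by (simp add: factor_sum_def power2_eq_square algebra_simps)
  also have "\<dots> = of_nat (Suc n) * central_binom n * square_ratio_prod (Suc n) n"
    unfolding square_ratio_prod_Suc_left[symmetric] by (simp flip: power_add)
  finally show ?thesis .
qed

lemma sum_mult_by_parts:
  fixes a b :: "nat \<Rightarrow> 'a :: comm_ring"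
  shows "(\<Sum>m<Suc n. a m * b m)
    = b n * (\<Sum>m<Suc n. a m) + (\<Sum>i<n. (b i - b (Suc i)) * (\<Sum>m<Suc i. a m))"
  by (induction n) (simp_all add: algebra_simps)

definition central_binom_sum :: "nat \<Rightarrow> rat" where
  "central_binom_sum n = (\<Sum>m<n. central_binom m)"

lemma alternating_apery_sum:
  assumes "n > 0"
  shows "(1 / of_nat n) * (\<Sum>k<n. (-1) ^ k * of_nat (2 * k + 1) * of_nat (apery k))
    = square_ratio_prod n (n - 1) * central_binom_sum n
      - (-1) ^ n * (\<Sum>i=1..<n. apery_weight n i * (central_binom_sum i / central_binom i))"
proof -
  obtain N where n: "n = Suc N"
    using assms gr0_conv_Suc by auto
  define b where "b m = factor_sum m n / central_binom m / of_nat n" for m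
  have "(1 / of_nat n) * (\<Sum>k<n. (-1) ^ k * of_nat (2 * k + 1) * of_nat (apery k))
      = (\<Sum>m<Suc N. central_binom m * b m)"
    unfolding sum_apery_eq_factor_sums sum_distrib_left n
    by (intro sum.cong refl) (simp add: b_def n)
  also have "\<dots> = b N * central_binom_sum n + (\<Sum>i<N. (b i - b (Suc i)) * central_binom_sum (Suc i))"
    unfolding sum_mult_by_parts central_binom_sum_def n ..
  also have "b N = square_ratio_prod n (n - 1)"
    by (simp add: b_def n factor_sum_diagonal del: of_nat_Suc)
  also have "(\<Sum>i<N. (b i - b (Suc i)) * central_binom_sum (Suc i))
      = (\<Sum>i=1..<n. (b (i - 1) - b i) * central_binom_sum i)"
    unfolding n One_nat_def sum.shift_bounds_Suc_ivl by (simp add: atLeast0LessThan)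
  also have "\<dots>
      = (\<Sum>i=1..<n. - ((-1) ^ n * (apery_weight n i * (central_binom_sum i / central_binom i))))"
  proof (intro sum.cong refl)
    fix i assume "i \<in> {1..<n}"
    then obtain j where i: "i = Suc j"
      by (cases i) auto
    have "b (i - 1) - b i = (factor_sum j n / central_binom j
        - factor_sum (Suc j) n / central_binom (Suc j)) / of_nat n"
      by (simp add: b_def i diff_divide_distrib)
    then show "(b (i - 1) - b i) * central_binom_sum i
        = - ((-1) ^ n * (apery_weight n i * (central_binom_sum i / central_binom i)))"
      unfolding factor_sum_ratio_diff using assms by (simp add: i del: of_nat_Suc)
  qed
  finally show ?thesis
    by (simp add: sum_negf sum_distrib_left)
qed

section \<open>Binomial sums twisted by the quadratic character modulo 3\<close>

definition chi3 :: "int \<Rightarrow> rat" where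
  "chi3 k = of_int (Legendre k 3)"

lemma chi3_eq: "chi3 k = (if k mod 3 = 1 then 1 else if k mod 3 = 2 then - 1 else 0)"
proof -
  have "k mod 3 = 0 \<or> k mod 3 = 1 \<or> k mod 3 = 2"
    by presburger
  moreover have "QuadRes 3 1"
    unfolding QuadRes_def by (rule exI[of _ 1]) simp
  moreover have "\<not> QuadRes 3 2"
  proof
    assume "QuadRes 3 2"
    then obtain y :: int where "y\<^sup>2 mod 3 = 2"
      by (auto simp: QuadRes_def cong_def)
    then have "(y mod 3)\<^sup>2 mod 3 = 2"
      by (simp add: power_mod)
    moreover have "y mod 3 = 0 \<or> y mod 3 = 1 \<or> y mod 3 = 2"
      by presburger
    ultimately show False
      by auto
  qed
  moreover have "QuadRes 3 k \<longleftrightarrow> QuadRes 3 (k mod 3)"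
    by (simp add: QuadRes_def cong_def)
  ultimately show ?thesis
    unfolding chi3_def Legendre_def by (auto simp: cong_def)
qed

lemma chi3_0 [simp]: "chi3 0 = 0" and chi3_1 [simp]: "chi3 1 = 1"
  by (simp_all add: chi3_eq)

lemma chi3_uminus: "chi3 (- k) = - chi3 k"
  unfolding chi3_eq by (simp; presburger)

lemma chi3_three_term: "chi3 (k + 2) = - chi3 (k + 1) - chi3 k"
proof -
  have "k mod 3 = 0 \<or> k mod 3 = 1 \<or> k mod 3 = 2"
    by presburger
  moreover have "(k + 1) mod 3 = (k mod 3 + 1) mod 3" "(k + 2) mod 3 = (k mod 3 + 2) mod 3"
    by (simp_all add: mod_add_left_eq)
  ultimately show ?thesis
    unfolding chi3_eq by (elim disjE) simp_all
qed

lemma chi3_square_eq_1: "\<not> 3 dvd k \<Longrightarrow> chi3 k * chi3 k = 1"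
  unfolding chi3_eq by (simp; presburger)

lemma chi3_symmetric:
  assumes "\<not> 3 dvd n"
  shows "chi3 (n - k) + chi3 n * of_bool (3 dvd n - k) = chi3 k + chi3 n * of_bool (3 dvd k)"
proof -
  have "n mod 3 = 1 \<or> n mod 3 = 2" "k mod 3 = 0 \<or> k mod 3 = 1 \<or> k mod 3 = 2"
    using assms by presburger+
  moreover have "(n - k) mod 3 = (n mod 3 - k mod 3) mod 3"
    by (simp add: mod_diff_eq)
  ultimately show ?thesis
    unfolding chi3_eq dvd_eq_mod_eq_0 by (elim disjE) simp_all
qed

lemma sum_choose_Suc:
  fixes f :: "nat \<Rightarrow> 'a :: comm_semiring_1"
  shows "(\<Sum>k\<le>Suc n. of_nat (Suc n choose k) * f k)
    = (\<Sum>k\<le>n. of_nat (n choose k) * (f k + f (Suc k)))"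
proof -
  have "(\<Sum>k\<le>n. of_nat (n choose k) * f k) = (\<Sum>k\<le>Suc n. of_nat (n choose k) * f k)"
    by (simp add: binomial_eq_0)
  also have "\<dots> = f 0 + (\<Sum>k\<le>n. of_nat (n choose Suc k) * f (Suc k))"
    by (subst sum.atMost_Suc_shift) simp
  finally show ?thesis
    by (subst sum.atMost_Suc_shift) (simp add: distrib_left distrib_right sum.distrib add_ac)
qed

lemma sum_choose_chi3_shift:
  "(\<Sum>k\<le>n. of_nat (n choose k) * chi3 (s + int k)) = (-1) ^ n * chi3 (s - int n)"
proof (induction n arbitrary: s)
  case (Suc n)
  have "(\<Sum>k\<le>Suc n. of_nat (Suc n choose k) * chi3 (s + int k))
      = (\<Sum>k\<le>n. of_nat (n choose k) * chi3 (s + int k))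
        + (\<Sum>k\<le>n. of_nat (n choose k) * chi3 ((s + 1) + int k))"
    unfolding sum_choose_Suc by (simp add: distrib_left sum.distrib add_ac)
  also have "\<dots> = (-1) ^ n * (chi3 (s - int n + 1) + chi3 (s - int n))"
    unfolding Suc.IH by (simp add: algebra_simps)
  also have "chi3 (s - int n + 1) + chi3 (s - int n) = - chi3 (s - int (Suc n))"
    using chi3_three_term[of "s - int n - 1"] by (simp add: algebra_simps)
  finally show ?case
    by simp
qed simp

lemma sum_choose_chi3: "(\<Sum>k=1..n. of_nat (n choose k) * chi3 (int k)) = (-1) ^ Suc n * chi3 (int n)"
  using sum_choose_chi3_shift[of n 0]
  by (simp add: chi3_uminus atMost_atLeast0 sum.atLeast_Suc_atMost)

lemma sum_choose_chi3_div:
  "(\<Sum>k=1..n. of_nat (n choose k) * chi3 (int k) / of_nat k)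
    = (\<Sum>k=1..n. (-1) ^ Suc k * chi3 (int k) / of_nat k)"
proof (induction n)
  case (Suc n)
  have choose_div: "of_nat (Suc n choose k) / of_nat k
      = (of_nat (n choose k) / of_nat k + of_nat (Suc n choose k) / of_nat (Suc n) :: rat)"
    if k: "k \<in> {1..Suc n}" for k
  proof -
    obtain l where l: "k = Suc l"
      using k by (cases k) auto
    have "of_nat (Suc l) * of_nat (Suc n choose Suc l)
        = (of_nat (Suc n) * of_nat (n choose l) :: rat)"
      by (simp only: Suc_times_binomial flip: of_nat_mult)
    then have "of_nat (n choose l) / of_nat (Suc l)
        = (of_nat (Suc n choose Suc l) / of_nat (Suc n) :: rat)"
      by (simp add: frac_eq_eq mult.commute del: of_nat_Suc binomial_Suc_Suc)
    then show ?thesis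
      unfolding l by (simp add: add_divide_distrib)
  qed
  have "(\<Sum>k=1..Suc n. of_nat (Suc n choose k) * chi3 (int k) / of_nat k)
      = (\<Sum>k=1..Suc n. of_nat (n choose k) * chi3 (int k) / of_nat k
        + of_nat (Suc n choose k) * chi3 (int k) / of_nat (Suc n))"
    by (intro sum.cong refl) (simp only: times_divide_eq_left[symmetric] choose_div distrib_right)
  also have "\<dots> = (\<Sum>k=1..n. of_nat (n choose k) * chi3 (int k) / of_nat k)
      + (\<Sum>k=1..Suc n. of_nat (Suc n choose k) * chi3 (int k)) / of_nat (Suc n)"
    by (simp only: sum.distrib sum_divide_distrib[symmetric]) (simp add: binomial_eq_0)
  also have "\<dots> = (\<Sum>k=1..Suc n. (-1) ^ Suc k * chi3 (int k) / of_nat k)"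
    unfolding Suc.IH sum_choose_chi3 by simp
  finally show ?case .
qed simp

definition alternating_chi3_sum :: "nat \<Rightarrow> nat \<Rightarrow> rat" where
  "alternating_chi3_sum r n = (\<Sum>k=1..<n. (-1) ^ Suc k * chi3 (int k) / of_nat k ^ r)"

lemma sum_choose_chi3_eq_0:
  assumes "odd n"
  shows "(\<Sum>k=1..<n. of_nat (n choose k) * chi3 (int k)) = 0"
  using sum_choose_chi3[of n] sum.last_plus[of 1 n "\<lambda>k. of_nat (n choose k) * chi3 (int k)"] assms
  by (simp add: odd_pos Suc_leI)

lemma sum_choose_pred_chi3_div:
  assumes "n > 0"
  shows "(\<Sum>k=1..<n. of_nat (n - 1 choose k) * chi3 (int k) / of_nat k) = alternating_chi3_sum 1 n"
  using sum_choose_chi3_div[of "n - 1"] assms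
  by (cases n) (simp_all add: alternating_chi3_sum_def atLeastLessThanSuc_atLeastAtMost)

lemma sum_choose_chi3_div_odd:
  assumes "odd n"
  shows "(\<Sum>k=1..<n. of_nat (n choose k) * chi3 (int k) / of_nat k) = alternating_chi3_sum 1 n"
  using sum_choose_chi3_div[of n] assms
    sum.last_plus[of 1 n "\<lambda>k. of_nat (n choose k) * chi3 (int k) / of_nat k"]
    sum.last_plus[of 1 n "\<lambda>k. (-1) ^ Suc k * chi3 (int k) / of_nat k"]
  by (simp add: alternating_chi3_sum_def odd_pos Suc_leI)

lemma sum_chi3_telescope:
  "(\<Sum>k=1..n. chi3 (int k) * (b (k + 1) + b k + b (k - 1)))
    = b 0 + chi3 (int n) * b (n + 1) - chi3 (int n + 1) * b n"
proof (induction n)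
  case (Suc n)
  have three_term: "chi3 (int n) = - chi3 (int n + 2) - chi3 (int n + 1)"
    using chi3_three_term[of "int n"] by simp
  have "(\<Sum>k=1..Suc n. chi3 (int k) * (b (k + 1) + b k + b (k - 1)))
      = b 0 + chi3 (int n) * b (n + 1) - chi3 (int n + 1) * b n
        + chi3 (int n + 1) * (b (n + 2) + b (n + 1) + b n)"
    using Suc.IH by (simp add: add.commute)
  also have "\<dots> = b 0 + chi3 (int (Suc n)) * b (Suc n + 1) - chi3 (int (Suc n) + 1) * b (Suc n)"
    unfolding three_term by (simp add: algebra_simps)
  finally show ?case .
qed simp

lemma choose_double_Suc:
  assumes "k \<ge> 1"
  shows "2 * Suc n choose (Suc n + k)
    = (2 * n choose (n + (k + 1))) + 2 * (2 * n choose (n + k)) + (2 * n choose (n + (k - 1)))"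
  using assms by (cases k) simp_all

lemma central_binom_sum_eq_sum_chi3_choose:
  "central_binom_sum n = (\<Sum>k=1..n. chi3 (int k) * of_nat (2 * n choose (n + k)))"
proof (induction n)
  case (Suc n)
  define b where "b k = (of_nat (2 * n choose (n + k)) :: rat)" for k
  have "(\<Sum>k=1..Suc n. chi3 (int k) * of_nat (2 * Suc n choose (Suc n + k)))
      = (\<Sum>k=1..Suc n. chi3 (int k) * (b (k + 1) + b k + b (k - 1)) + chi3 (int k) * b k)"
    by (intro sum.cong refl, subst choose_double_Suc) (simp_all add: b_def algebra_simps)
  also have "\<dots> = b 0 + (\<Sum>k=1..n. chi3 (int k) * b k)"
    unfolding sum.distrib sum_chi3_telescope by (simp add: b_def binomial_eq_0)
  also have "\<dots> = central_binom_sum (Suc n)"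
    using Suc.IH by (simp add: central_binom_sum_def central_binom_def b_def)
  finally show ?case ..
qed (simp add: central_binom_sum_def)

definition binom_ratio :: "nat \<Rightarrow> nat \<Rightarrow> rat" where
  "binom_ratio n k = of_nat (n choose k) / of_nat ((n + k) choose k)"

lemma central_binom_times_binom_ratio:
  assumes "k \<le> n"
  shows "central_binom n * binom_ratio n k = of_nat (2 * n choose (n + k))"
proof -
  have "(2 * n choose (n + k)) * ((n + k) choose n) = (2 * n choose n) * (n choose k)"
    using choose_mult[of n "n + k" "2 * n"] assms by simp
  then have "of_nat (2 * n choose (n + k)) * of_nat ((n + k) choose k)
      = (of_nat (2 * n choose n) * of_nat (n choose k) :: rat)"
    by (simp add: binomial_symmetric[of n "n + k"] flip: of_nat_mult)
  then show ?thesis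
    by (simp add: central_binom_def binom_ratio_def field_simps)
qed

definition chi3_ratio_sum :: "nat \<Rightarrow> rat" where
  "chi3_ratio_sum n = (\<Sum>k=1..n. chi3 (int k) * binom_ratio n k)"

definition proper_chi3_ratio_sum :: "nat \<Rightarrow> rat" where
  "proper_chi3_ratio_sum n = (\<Sum>k=1..<n. chi3 (int k) * binom_ratio n k)"

lemma central_binom_sum_eq_chi3_ratio_sum:
  "central_binom_sum n = central_binom n * chi3_ratio_sum n"
  unfolding central_binom_sum_eq_sum_chi3_choose chi3_ratio_sum_def sum_distrib_left
  by (intro sum.cong refl)
    (simp add: mult.left_commute[of "central_binom n"] central_binom_times_binom_ratio)

lemma central_binom_sum_eq_proper_chi3_ratio_sum:
  assumes "n > 0"
  shows "central_binom_sum n = chi3 (int n) + central_binom n * proper_chi3_ratio_sum n"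
proof -
  have "chi3_ratio_sum n = chi3 (int n) * binom_ratio n n + proper_chi3_ratio_sum n"
    unfolding chi3_ratio_sum_def proper_chi3_ratio_sum_def
    using assms by (intro sum.last_plus) (simp add: Suc_leI)
  moreover have "central_binom n * binom_ratio n n = 1"
    by (simp add: central_binom_times_binom_ratio flip: mult_2)
  ultimately show ?thesis
    by (simp add: central_binom_sum_eq_chi3_ratio_sum distrib_left mult.left_commute)
qed

lemma binom_ratio_Suc_left:
  "of_nat (Suc n) ^ 2 * binom_ratio n k
    = (of_nat (Suc n) ^ 2 - of_nat k ^ 2) * binom_ratio (Suc n) k"
proof -
  have upper: "(of_nat (Suc n) - of_nat k) * of_nat (Suc n choose k)
      = (of_nat (Suc n) * of_nat (n choose k) :: rat)"
    using gbinomial_absorb_comp[of "of_nat (Suc n) :: rat" k] by (simp add: binomial_gbinomial)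
  have lower: "of_nat (Suc n) * of_nat ((Suc n + k) choose k)
      = ((of_nat (Suc n) + of_nat k) * of_nat ((n + k) choose k) :: rat)"
    using arg_cong[OF binomial_absorb_comp[of "Suc n + k" k], of "of_nat :: nat \<Rightarrow> rat"]
    by (simp add: algebra_simps)
  have "of_nat (Suc n) ^ 2 * of_nat (n choose k) * of_nat ((Suc n + k) choose k)
      = (of_nat (Suc n) * of_nat (n choose k))
        * (of_nat (Suc n) * of_nat ((Suc n + k) choose k) :: rat)"
    by (simp only: power2_eq_square mult_ac)
  also have "\<dots> = (of_nat (Suc n) ^ 2 - of_nat k ^ 2) * of_nat (Suc n choose k)
      * of_nat ((n + k) choose k)"
    unfolding upper[symmetric] lower by (simp add: power2_eq_square algebra_simps)
  finally show ?thesis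
    unfolding binom_ratio_def times_divide_eq_right by (subst frac_eq_eq) simp_all
qed

lemma sum_chi3_ratio_sum_div_square:
  "(\<Sum>i=1..n. chi3_ratio_sum i / of_nat i ^ 2)
    = (\<Sum>k=1..n. chi3 (int k) * binom_ratio n k / of_nat k ^ 2)"
proof (induction n)
  case (Suc n)
  have ratio_div: "binom_ratio (Suc n) k / of_nat k ^ 2
      = binom_ratio n k / of_nat k ^ 2 + binom_ratio (Suc n) k / of_nat (Suc n) ^ 2"
    if "k \<in> {1..Suc n}" for k
  proof -
    have "binom_ratio n k
        = (of_nat (Suc n) ^ 2 - of_nat k ^ 2) * binom_ratio (Suc n) k / of_nat (Suc n) ^ 2"
      by (simp flip: binom_ratio_Suc_left del: of_nat_Suc)
    then show ?thesis
      using that by (simp add: field_simps del: of_nat_Suc)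
  qed
  have "(\<Sum>k=1..Suc n. chi3 (int k) * binom_ratio (Suc n) k / of_nat k ^ 2)
      = (\<Sum>k=1..Suc n. chi3 (int k) * binom_ratio n k / of_nat k ^ 2
        + chi3 (int k) * binom_ratio (Suc n) k / of_nat (Suc n) ^ 2)"
    by (intro sum.cong refl) (simp only: times_divide_eq_right[symmetric] ratio_div distrib_left)
  also have "\<dots> = (\<Sum>k=1..n. chi3 (int k) * binom_ratio n k / of_nat k ^ 2)
      + chi3_ratio_sum (Suc n) / of_nat (Suc n) ^ 2"
    unfolding sum.distrib chi3_ratio_sum_def sum_divide_distrib by (simp add: binom_ratio_def)
  finally show ?case
    using Suc.IH by simp
qed simp

section \<open>Harmonic sums modulo a prime\<close>

definition harmonic :: "nat \<Rightarrow> nat \<Rightarrow> rat" where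
  "harmonic r n = (\<Sum>k=1..n. 1 / of_nat k ^ r)"

lemma harmonic_0 [simp]: "harmonic r 0 = 0"
  by (simp add: harmonic_def)

lemma harmonic_Suc: "harmonic r (Suc n) = harmonic r n + 1 / of_nat (Suc n) ^ r"
  by (simp add: harmonic_def)

lemma sum_multiples:
  fixes f :: "nat \<Rightarrow> 'a :: comm_monoid_add"
  assumes "d > 0"
  shows "(\<Sum>k\<in>{k\<in>{1..n}. d dvd k}. f k) = (\<Sum>j=1..n div d. f (d * j))"
proof (rule sum.reindex_bij_witness[of _ "\<lambda>j. d * j" "\<lambda>k. k div d"])
  fix k assume "k \<in> {k\<in>{1..n}. d dvd k}"
  then show "k div d \<in> {1..n div d}"
    using assms by (auto simp: div_le_mono elim!: dvdE)
next
  fix j assume "j \<in> {1..n div d}"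
  then show "d * j \<in> {k\<in>{1..n}. d dvd k}"
    using assms by (auto simp: less_eq_div_iff_mult_less_eq mult.commute)
qed (use assms in auto)

locale prime_localization = localization +
  assumes prime_p: "prime p"
begin

lemma p_pos [simp]: "p > 0"
  using prime_p by (rule prime_gt_0_nat)

lemma p_integers_inverse_not_dvd: "\<not> p dvd k \<Longrightarrow> 1 / of_nat k \<in> p_integers"
  using prime_imp_coprime[OF prime_p, of k]
  by (intro p_integers_inverse) (simp add: coprime_commute)

lemma pcong_inverse:
  assumes "[d * m = 1] (mod p)"
  shows "of_nat m \<equiv>\<^bsub>1\<^esub> 1 / of_nat d"
proof (rule pcong_cancel)
  have "\<not> p dvd d"
    using assms prime_p cong_dvd_iff[of "d * m" 1 p] by auto
  then show "1 / of_nat d \<in> p_integers" "(of_nat d :: rat) \<noteq> 0"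
    by (auto intro: p_integers_inverse_not_dvd intro!: gr0I)
  then show "of_nat d * of_nat m \<equiv>\<^bsub>1\<^esub> of_nat d * (1 / of_nat d)"
    using pcong_of_nat[of "d * m" 1 1] assms by simp
qed

lemma p_integers_inverse_less: "0 < k \<Longrightarrow> k < p \<Longrightarrow> 1 / of_nat k \<in> p_integers"
  by (rule p_integers_inverse_not_dvd) (auto dest: dvd_imp_le)

lemma pcong_p_integers:
  assumes "x \<equiv>\<^bsub>m\<^esub> y" "y \<in> p_integers"
  shows "x \<in> p_integers"
  using pcong_mono[OF assms(1), of 0] p_integers_add[OF _ assms(2), of "x - y"]
  by (simp add: pcong_def)

lemma prod_one_plus_pcong:
  assumes "\<And>t. t \<in> A \<Longrightarrow> z t \<equiv>\<^bsub>m\<^esub> 0"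
  shows "(\<Prod>t\<in>A. 1 + z t) \<equiv>\<^bsub>m + m\<^esub> 1 + (\<Sum>t\<in>A. z t)"
  using assms
proof (induction A rule: infinite_finite_induct)
  case (insert t A)
  have z: "z t \<equiv>\<^bsub>m\<^esub> 0" "(\<Sum>t\<in>A. z t) \<equiv>\<^bsub>m\<^esub> 0"
    using pcong_sum[of A z m "\<lambda>_. 0"] insert.prems by simp_all
  have "(1 + z t) * (\<Prod>t\<in>A. 1 + z t) \<equiv>\<^bsub>m + m\<^esub> (1 + z t) * (1 + (\<Sum>t\<in>A. z t))"
    using insert pcong_p_integers[OF z(1)] by (intro pcong_mult_left p_integers_add) simp_all
  also have "\<dots> = 1 + (z t + (\<Sum>t\<in>A. z t)) + z t * (\<Sum>t\<in>A. z t)"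
    by (simp add: algebra_simps)
  also have "\<dots> \<equiv>\<^bsub>m + m\<^esub> 1 + (z t + (\<Sum>t\<in>A. z t)) + z t * 0"
    using pcong_mult_raise[OF z refl] by (intro pcong_add pcong_refl)
  finally show ?case
    using insert.hyps by simp
qed simp_all

lemma p_integers_inverse_power_less:
  assumes "0 < k" "k < p"
  shows "1 / of_nat k ^ r \<in> p_integers"
  using p_integers_power[OF p_integers_inverse_less[OF assms], of r] by (simp add: power_one_over)

lemma p_integers_chi3 [simp]: "chi3 k \<in> p_integers"
  by (simp add: chi3_def)

lemma p_integers_harmonic: "n < p \<Longrightarrow> harmonic r n \<in> p_integers"
  unfolding harmonic_def by (intro p_integers_sum p_integers_inverse_power_less) auto

lemma p_integers_bernoulli_num: "n < p - 1 \<Longrightarrow> bernoulli_num n \<in> p_integers"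
proof (induction n rule: less_induct)
  case (less n)
  have "1 / of_nat (Suc n) * (\<Sum>k<n. of_nat (Suc n choose k) * bernoulli_num k) \<in> p_integers"
    using less by (intro p_integers_mult p_integers_sum p_integers_inverse_less) auto
  then show ?case
    using p_integers_uminus by (subst bernoulli_num.simps) auto
qed

lemma bernoulli_poly_pcong:
  assumes "x \<equiv>\<^bsub>m\<^esub> y" "x \<in> p_integers" "y \<in> p_integers" "n < p - 1"
  shows "bernoulli_poly n x \<equiv>\<^bsub>m\<^esub> bernoulli_poly n y"
  unfolding bernoulli_poly_def
  using assms
  by (intro pcong_sum pcong_mult_left pcong_power p_integers_mult p_integers_bernoulli_num) auto

lemma inverse_power_pcong:
  assumes "0 < k" "k < p" "r \<le> p - 1"
  shows "1 / of_nat k ^ r \<equiv>\<^bsub>1\<^esub> of_nat k ^ (p - 1 - r)"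
proof (rule pcong_sym)
  have "\<not> p dvd k"
    using assms by (auto dest: dvd_imp_le)
  then have fermat: "of_nat (k ^ (p - 1)) \<equiv>\<^bsub>1\<^esub> of_nat 1"
    using fermat_theorem[OF prime_p] by (intro pcong_of_nat) simp
  have "of_nat k ^ (p - 1 - r) = (1 / of_nat k ^ r * of_nat (k ^ (p - 1)) :: rat)"
    using power_diff[of "of_nat k :: rat" r "p - 1"] assms by simp
  also have "\<dots> \<equiv>\<^bsub>1\<^esub> 1 / of_nat k ^ r * of_nat 1"
    using assms fermat by (intro pcong_mult_left p_integers_inverse_power_less)
  finally show "of_nat k ^ (p - 1 - r) \<equiv>\<^bsub>1\<^esub> 1 / of_nat k ^ r"
    by simp
qed

lemma harmonic_pcong_bernoulli_poly:
  assumes "0 < r" "r < p - 1" "n < p"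
  shows "of_nat r * harmonic r n \<equiv>\<^bsub>1\<^esub> bernoulli_num (p - r) - bernoulli_poly (p - r) (of_nat n + 1)"
proof -
  have r: "of_nat r = (of_nat p - of_nat (p - r) :: rat)"
    using assms by (simp add: of_nat_diff)
  have "of_nat p ^ 1 * harmonic r n \<equiv>\<^bsub>1\<^esub> 0"
    using assms by (intro pcong_power_mult_0 p_integers_harmonic)
  moreover have "of_nat (p - r) * harmonic r n
      \<equiv>\<^bsub>1\<^esub> of_nat (p - r) * (\<Sum>k=1..n. of_nat k ^ (p - 1 - r))"
    unfolding harmonic_def using assms
    by (intro pcong_mult_left pcong_sum inverse_power_pcong) auto
  moreover have "of_nat (p - r) * (\<Sum>k=1..n. of_nat k ^ (p - 1 - r))
      = bernoulli_poly (p - r) (of_nat n + 1) - bernoulli_num (p - r)"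
  proof -
    have "(\<Sum>k<Suc n. of_nat k ^ (p - r - 1)) = (\<Sum>k=1..n. of_nat k ^ (p - 1 - r) :: rat)"
      using assms
      by (simp add: lessThan_Suc_atMost atMost_atLeast0 sum.atLeast_Suc_atMost diff_right_commute)
    then show ?thesis
      using sum_powers_eq_bernoulli_poly[of "p - r" "Suc n"] by (simp add: add.commute)
  qed
  ultimately have "of_nat p ^ 1 * harmonic r n - of_nat (p - r) * harmonic r n
      \<equiv>\<^bsub>1\<^esub> 0 - (bernoulli_poly (p - r) (of_nat n + 1) - bernoulli_num (p - r))"
    by (intro pcong_diff) simp_all
  then show ?thesis
    unfolding r by (simp add: left_diff_distrib)
qed

lemma harmonic_full_pcong_0:
  assumes "2 \<le> r" "r < p - 1"
  shows "harmonic r (p - 1) \<equiv>\<^bsub>1\<^esub> 0"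
proof (rule pcong_cancel)
  have "of_nat r * harmonic r (p - 1)
      \<equiv>\<^bsub>1\<^esub> bernoulli_num (p - r) - bernoulli_poly (p - r) (of_nat p)"
    using harmonic_pcong_bernoulli_poly[of r "p - 1"] assms by (simp add: of_nat_diff)
  also have "\<dots> \<equiv>\<^bsub>1\<^esub> bernoulli_num (p - r) - bernoulli_poly (p - r) 0"
    using pcong_power_0[of 1] assms by (intro pcong_diff bernoulli_poly_pcong) auto
  finally show "of_nat r * harmonic r (p - 1) \<equiv>\<^bsub>1\<^esub> of_nat r * 0"
    by (simp add: bernoulli_poly_0)
qed (use assms in \<open>auto intro: p_integers_inverse_less\<close>)

lemma inverse_power_reflect_pcong:
  assumes "0 < k" "k < p"
  shows "1 / of_nat (p - k) ^ r \<equiv>\<^bsub>1\<^esub> (-1) ^ r / of_nat k ^ r"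
proof -
  have "1 / of_nat (p - k) - - (1 / of_nat k)
      = of_nat p ^ 1 * (1 / of_nat k * (1 / of_nat (p - k)) :: rat)"
    using assms by (simp add: of_nat_diff field_simps)
  also have "\<dots> \<equiv>\<^bsub>1\<^esub> 0"
    using assms by (intro pcong_power_mult_0 p_integers_mult p_integers_inverse_less) auto
  finally have "1 / of_nat (p - k) \<equiv>\<^bsub>1\<^esub> - (1 / of_nat k)"
    by (simp add: pcong_def)
  then have "(1 / of_nat (p - k)) ^ r \<equiv>\<^bsub>1\<^esub> (- (1 / of_nat k)) ^ r"
    using assms by (intro pcong_power p_integers_uminus p_integers_inverse_less) auto
  then show ?thesis
    by (simp add: power_minus[of "1 / of_nat k"] power_one_over)
qed

lemma harmonic_reflect_pcong:
  assumes "2 \<le> r" "r < p - 1" "n < p"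
  shows "harmonic r (p - 1 - n) \<equiv>\<^bsub>1\<^esub> - ((-1) ^ r * harmonic r n)"
  using \<open>n < p\<close>
proof (induction n)
  case 0
  then show ?case
    using harmonic_full_pcong_0 assms by simp
next
  case (Suc n)
  have "p - 1 - n = Suc (p - 1 - Suc n)"
    using Suc.prems by simp
  then have "harmonic r (p - 1 - Suc n) = harmonic r (p - 1 - n) - 1 / of_nat (p - Suc n) ^ r"
    using Suc.prems by (simp add: harmonic_Suc del: of_nat_Suc)
  also have "\<dots> \<equiv>\<^bsub>1\<^esub> - ((-1) ^ r * harmonic r n) - (-1) ^ r / of_nat (Suc n) ^ r"
    using Suc by (intro pcong_diff inverse_power_reflect_pcong) auto
  also have "\<dots> = - ((-1) ^ r * harmonic r (Suc n))"
    by (simp add: harmonic_Suc distrib_left)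
  finally show ?case .
qed

end

locale odd_prime_localization = prime_localization +
  assumes odd_p: "odd p"
begin

lemma p_integers_inverse_2: "1 / 2 \<in> p_integers"
proof -
  have "p > 2"
    using prime_gt_1_nat[OF prime_p] odd_p by (cases "p = 2") auto
  then show ?thesis
    using p_integers_inverse_less[of 2] by simp
qed

lemma pcong_halve_0: "2 * x \<equiv>\<^bsub>m\<^esub> 0 \<Longrightarrow> x \<equiv>\<^bsub>m\<^esub> 0"
  using pcong_cancel[of 2 x m 0] p_integers_inverse_2 by simp

lemma harmonic_even_pcong_bernoulli_poly:
  assumes "even r" "2 \<le> r" "r < p - 1" "n < p" "of_nat n + 1 \<equiv>\<^bsub>1\<^esub> x" "x \<in> p_integers"
  shows "of_nat r * harmonic r n \<equiv>\<^bsub>1\<^esub> - bernoulli_poly (p - r) x"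
proof -
  have "odd (p - r)" "p - r \<noteq> 1"
    using odd_p assms by auto
  then have "bernoulli_num (p - r) = 0"
    by (rule bernoulli_num_odd)
  then have "of_nat r * harmonic r n \<equiv>\<^bsub>1\<^esub> - bernoulli_poly (p - r) (of_nat n + 1)"
    using harmonic_pcong_bernoulli_poly[of r n] assms by simp
  also have "\<dots> \<equiv>\<^bsub>1\<^esub> - bernoulli_poly (p - r) x"
    using assms by (intro pcong_uminus bernoulli_poly_pcong p_integers_add) auto
  finally show ?thesis .
qed

lemma harmonic_half_pcong_0:
  assumes "even r" "2 \<le> r" "r < p - 1"
  shows "harmonic r ((p - 1) div 2) \<equiv>\<^bsub>1\<^esub> 0"
proof (rule pcong_halve_0)
  have "p - 1 - (p - 1) div 2 = (p - 1) div 2"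
    using odd_p by (auto elim!: oddE)
  then have "harmonic r ((p - 1) div 2) \<equiv>\<^bsub>1\<^esub> - harmonic r ((p - 1) div 2)"
    using harmonic_reflect_pcong[of r "(p - 1) div 2"] assms by simp
  then show "2 * harmonic r ((p - 1) div 2) \<equiv>\<^bsub>1\<^esub> 0"
    by (simp add: pcong_def)
qed

lemma sum_antisymmetric_pcong_0:
  assumes "\<And>k. 0 < k \<Longrightarrow> k < p \<Longrightarrow> f k \<in> p_integers"
    and "\<And>k. 0 < k \<Longrightarrow> k < p \<Longrightarrow> f (p - k) = - f k" and "even r"
  shows "(\<Sum>k=1..<p. f k / of_nat k ^ r) \<equiv>\<^bsub>1\<^esub> 0"
proof (rule pcong_halve_0)
  define S where "S = (\<Sum>k=1..<p. f k / of_nat k ^ r)"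
  have "S = (\<Sum>k=1..<p. f (p - k) * (1 / of_nat (p - k) ^ r))"
    unfolding S_def by (rule sum.reindex_bij_witness[of _ "\<lambda>k. p - k" "\<lambda>k. p - k"]) auto
  also have "\<dots> \<equiv>\<^bsub>1\<^esub> (\<Sum>k=1..<p. f (p - k) * ((-1) ^ r / of_nat k ^ r))"
    using assms(1) by (intro pcong_sum pcong_mult_left inverse_power_reflect_pcong) auto
  also have "\<dots> = (\<Sum>k=1..<p. - (f k / of_nat k ^ r))"
    using assms by (intro sum.cong refl) simp
  also have "\<dots> = - S"
    by (simp add: S_def sum_negf)
  finally show "2 * S \<equiv>\<^bsub>1\<^esub> 0"
    by (simp add: pcong_def)
qed

end

section \<open>Evaluation of the alternating character sum modulo a prime\<close>

locale prime_gt_3_localization = prime_localization +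
  assumes p_gt_3: "p > 3"
begin

sublocale odd_prime_localization
  using prime_p p_gt_3 by unfold_locales (simp add: prime_odd_nat)

lemma p_gt_4: "p > 4"
  using p_gt_3 odd_p by (cases "p = 4") auto

lemma not_3_dvd_p: "\<not> 3 dvd p"
  using prime_p p_gt_3 primes_dvd_imp_eq[of 3 p] by auto

lemma p_integers_inverse_3: "1 / 3 \<in> p_integers"
  using p_integers_inverse_less[of 3] p_gt_3 by simp

lemma harmonic_third_pcong:
  assumes "even r" "2 \<le> r" "r < p - 1"
  shows "of_nat r * harmonic r (p div 3) \<equiv>\<^bsub>1\<^esub> chi3 (int p) * bernoulli_poly (p - r) (1 / 3)"
proof -
  define N where "N = p div 3"
  have bernoulli: "of_nat r * harmonic r n \<equiv>\<^bsub>1\<^esub> - bernoulli_poly (p - r) (1 / 3)"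
    if "3 * Suc n = 1 + c * p" "n < p" for n c
  proof -
    have "[3 * Suc n = 1] (mod p)"
      unfolding that(1) cong_def by (rule mod_mult_self1)
    then have "of_nat n + 1 \<equiv>\<^bsub>1\<^esub> 1 / 3"
      using pcong_inverse[of 3 "Suc n"] by (simp add: add.commute)
    then show ?thesis
      using assms that(2) p_integers_inverse_3 by (intro harmonic_even_pcong_bernoulli_poly)
  qed
  have "p = 3 * N + 1 \<or> p = 3 * N + 2"
    using not_3_dvd_p unfolding N_def by presburger
  then show ?thesis
    unfolding N_def[symmetric]
  proof
    assume p: "p = 3 * N + 1"
    then have "harmonic r (2 * N) \<equiv>\<^bsub>1\<^esub> - harmonic r N"
      using harmonic_reflect_pcong[of r N] assms by simp
    then have "harmonic r N \<equiv>\<^bsub>1\<^esub> - harmonic r (2 * N)"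
      using pcong_sym[OF pcong_uminus] by fastforce
    then have "of_nat r * harmonic r N \<equiv>\<^bsub>1\<^esub> - (of_nat r * harmonic r (2 * N))"
      using pcong_mult_left[of "of_nat r"] by fastforce
    also have "\<dots> \<equiv>\<^bsub>1\<^esub> - (- bernoulli_poly (p - r) (1 / 3))"
      using p by (intro pcong_uminus bernoulli[of _ 2]) auto
    finally show "of_nat r * harmonic r N \<equiv>\<^bsub>1\<^esub> chi3 (int p) * bernoulli_poly (p - r) (1 / 3)"
      by (simp add: p chi3_eq)
  next
    assume p: "p = 3 * N + 2"
    have "of_nat r * harmonic r N \<equiv>\<^bsub>1\<^esub> - bernoulli_poly (p - r) (1 / 3)"
      using p by (intro bernoulli[of _ 1]) auto
    then show "of_nat r * harmonic r N \<equiv>\<^bsub>1\<^esub> chi3 (int p) * bernoulli_poly (p - r) (1 / 3)"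
      by (simp add: p chi3_eq)
  qed
qed

lemma even_inverse_powers_sum:
  "(\<Sum>k\<in>{k\<in>{1..n}. even k}. 1 / of_nat k ^ r) = harmonic r (n div 2) / 2 ^ r"
  unfolding sum_multiples[OF zero_less_numeral] harmonic_def sum_divide_distrib
  by (simp add: power_mult_distrib mult.commute)

lemma odd_inverse_powers_third_pcong:
  assumes "even r" "2 \<le> r" "r < p - 1"
  shows "(\<Sum>k\<in>{k\<in>{1..p div 3}. odd k}. 1 / of_nat k ^ r) \<equiv>\<^bsub>1\<^esub> - (harmonic r (p div 3) / 2 ^ r)"
proof -
  define N where "N = p div 3"
  have N: "p = 3 * N + 1 \<or> p = 3 * N + 2"
    using not_3_dvd_p unfolding N_def by presburger
  have reflect: "1 / of_nat (p - k) ^ r \<equiv>\<^bsub>1\<^esub> 1 / of_nat k ^ r" if "0 < k" "k < p" for k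
    using inverse_power_reflect_pcong[OF that, of r] \<open>even r\<close> by simp
  have "(\<Sum>k\<in>{k\<in>{1..N}. odd k}. 1 / of_nat k ^ r)
      \<equiv>\<^bsub>1\<^esub> (\<Sum>k\<in>{k\<in>{1..N}. odd k}. 1 / of_nat (p - k) ^ r)"
    using N by (intro pcong_sum pcong_sym[OF reflect]) auto
  also have "\<dots> = (\<Sum>k\<in>{k\<in>{1..p - 1}. even k} - {k\<in>{1..2 * N}. even k}. 1 / of_nat k ^ r)"
  proof (rule sum.reindex_bij_witness[of _ "\<lambda>k. p - k" "\<lambda>k. p - k"])
    fix k assume k: "k \<in> {k\<in>{1..p - 1}. even k} - {k\<in>{1..2 * N}. even k}"
    then have "odd (p - k)"
      using odd_p by auto
    moreover have "p - k \<noteq> N + 1"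
      using N k odd_p calculation by auto
    ultimately show "p - k \<in> {k\<in>{1..N}. odd k}"
      using k N by auto
  qed (use N odd_p in auto)
  also have "\<dots> = (\<Sum>k\<in>{k\<in>{1..p - 1}. even k}. 1 / of_nat k ^ r)
      - (\<Sum>k\<in>{k\<in>{1..2 * N}. even k}. 1 / of_nat k ^ r)"
    using N by (intro sum_diff) auto
  also have "\<dots> = 1 / 2 ^ r * harmonic r ((p - 1) div 2) - harmonic r N / 2 ^ r"
    unfolding even_inverse_powers_sum by simp
  also have "\<dots> \<equiv>\<^bsub>1\<^esub> 1 / 2 ^ r * 0 - harmonic r N / 2 ^ r"
    using assms p_integers_inverse_power_less[of 2 r] p_gt_3
    by (intro pcong_diff pcong_mult_left harmonic_half_pcong_0) auto
  finally show ?thesis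
    by (simp add: N_def)
qed

lemma alternating_inverse_powers_third_pcong:
  assumes "even r" "2 \<le> r" "r < p - 1"
  shows "(\<Sum>k=1..p div 3. (-1) ^ k / of_nat k ^ r) \<equiv>\<^bsub>1\<^esub> (1 + 2 / 2 ^ r) * harmonic r (p div 3)"
proof -
  define S where "S = (\<Sum>k\<in>{k\<in>{1..p div 3}. odd k}. 1 / (of_nat k ^ r :: rat))"
  have "S = (\<Sum>k=1..p div 3. if odd k then 1 / of_nat k ^ r else 0)"
    unfolding S_def by (rule sum.inter_filter) simp
  then have "(\<Sum>k=1..p div 3. (-1) ^ k / of_nat k ^ r) = harmonic r (p div 3) - 2 * S"
    unfolding harmonic_def
    by (simp only: sum_distrib_left sum_subtractf[symmetric]) (intro sum.cong refl, auto)
  also have "\<dots> \<equiv>\<^bsub>1\<^esub> harmonic r (p div 3) - 2 * (- (harmonic r (p div 3) / 2 ^ r))"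
    unfolding S_def using assms
    by (intro pcong_diff pcong_mult_left odd_inverse_powers_third_pcong) simp_all
  finally show ?thesis
    by (simp add: algebra_simps)
qed

lemma alternating_inverse_powers_multiples_of_3:
  "(\<Sum>k=1..<p. of_bool (3 dvd k) * (-1) ^ k / of_nat k ^ r)
    = (1 / 3 ^ r) * (\<Sum>j=1..p div 3. (-1) ^ j / (of_nat j ^ r :: rat))"
proof -
  have "(\<Sum>k=1..<p. of_bool (3 dvd k) * (-1) ^ k / of_nat k ^ r)
      = (\<Sum>k=1..<p. if 3 dvd k then (-1) ^ k / (of_nat k ^ r :: rat) else 0)"
    by (intro sum.cong) auto
  also have "\<dots> = (\<Sum>k\<in>{k\<in>{1..<p}. 3 dvd k}. (-1) ^ k / of_nat k ^ r)"
    by (rule sum.inter_filter[symmetric]) simp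
  also have "{k\<in>{1..<p}. 3 dvd k} = {k\<in>{1..p}. 3 dvd k}"
    using not_3_dvd_p by (auto simp: order.strict_iff_order)
  also have "(\<Sum>k\<in>\<dots>. (-1) ^ k / of_nat k ^ r)
      = (1 / 3 ^ r) * (\<Sum>j=1..p div 3. (-1) ^ j / (of_nat j ^ r :: rat))"
    unfolding sum_multiples[OF zero_less_numeral] sum_distrib_left
    by (intro sum.cong refl) (simp add: power_mult power_mult_distrib)
  finally show ?thesis .
qed

lemma alternating_chi3_sum_pcong_multiples_of_3:
  assumes "even r"
  shows "alternating_chi3_sum r p
    \<equiv>\<^bsub>1\<^esub> chi3 (int p) * (1 / 3 ^ r) * (\<Sum>j=1..p div 3. (-1) ^ j / of_nat j ^ r)"
proof -
  define f where "f k = (-1) ^ k * (chi3 (int k) + chi3 (int p) * of_bool (3 dvd k))" for k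
  have antisymmetric: "f (p - k) = - f k" if "k < p" for k
  proof -
    have "(-1) ^ (p - k) = (- ((-1) ^ k) :: rat)"
      using that odd_p by (cases "even k") auto
    moreover have "chi3 (int (p - k)) + chi3 (int p) * of_bool (3 dvd p - k)
        = chi3 (int k) + chi3 (int p) * of_bool (3 dvd k)"
      using chi3_symmetric[of "int p" "int k"] not_3_dvd_p that
        int_dvd_int_iff[of 3 "p - k"] int_dvd_int_iff[of 3 k] int_dvd_int_iff[of 3 p]
      by (simp add: of_nat_diff)
    ultimately show ?thesis
      by (simp add: f_def)
  qed
  have "(\<Sum>k=1..<p. f k / of_nat k ^ r)
      = (\<Sum>k=1..<p. (-1) ^ k * chi3 (int k) / of_nat k ^ r)
        + chi3 (int p) * (\<Sum>k=1..<p. of_bool (3 dvd k) * (-1) ^ k / of_nat k ^ r)"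
    unfolding f_def sum_distrib_left sum.distrib[symmetric]
    by (intro sum.cong refl) (simp add: distrib_left add_divide_distrib)
  also have "\<dots> = - alternating_chi3_sum r p
      + chi3 (int p) * (1 / 3 ^ r) * (\<Sum>j=1..p div 3. (-1) ^ j / of_nat j ^ r)"
    unfolding alternating_chi3_sum_def alternating_inverse_powers_multiples_of_3 mult.assoc
    by (simp add: sum_negf)
  finally have "- alternating_chi3_sum r p
      + chi3 (int p) * (1 / 3 ^ r) * (\<Sum>j=1..p div 3. (-1) ^ j / of_nat j ^ r)
      = (\<Sum>k=1..<p. f k / of_nat k ^ r)" ..
  also have "\<dots> \<equiv>\<^bsub>1\<^esub> 0"
    using assms antisymmetric
    by (intro sum_antisymmetric_pcong_0) (auto simp: f_def intro!: p_integers_mult p_integers_add)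
  finally show ?thesis
    by (intro pcong_sym[of _ 1 "alternating_chi3_sum r p"]) (simp add: pcong_def)
qed

lemma alternating_chi3_sum_2_pcong:
  "alternating_chi3_sum 2 p \<equiv>\<^bsub>1\<^esub> bernoulli_poly (p - 2) (1 / 3) / 12"
proof -
  have "1 / 9 \<in> p_integers"
    using p_integers_mult[OF p_integers_inverse_3 p_integers_inverse_3] by simp
  have "1 / 2 * (1 / 2 * (1 / 3)) \<in> p_integers"
    by (intro p_integers_mult p_integers_inverse_2 p_integers_inverse_3)
  then have "1 / 12 \<in> p_integers"
    by simp
  have "alternating_chi3_sum 2 p
      \<equiv>\<^bsub>1\<^esub> chi3 (int p) * (1 / 9) * (\<Sum>j=1..p div 3. (-1) ^ j / of_nat j ^ 2)"
    using alternating_chi3_sum_pcong_multiples_of_3[of 2] by simp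
  also have "\<dots> \<equiv>\<^bsub>1\<^esub> chi3 (int p) * (1 / 9) * ((1 + 2 / 2 ^ 2) * harmonic 2 (p div 3))"
    using \<open>1 / 9 \<in> p_integers\<close> p_gt_4
    by (intro pcong_mult_left alternating_inverse_powers_third_pcong p_integers_mult) simp_all
  also have "\<dots> = chi3 (int p) * (1 / 12) * (of_nat 2 * harmonic 2 (p div 3))"
    by simp
  also have "\<dots> \<equiv>\<^bsub>1\<^esub> chi3 (int p) * (1 / 12) * (chi3 (int p) * bernoulli_poly (p - 2) (1 / 3))"
    using \<open>1 / 12 \<in> p_integers\<close> p_gt_4
    by (intro pcong_mult_left harmonic_third_pcong p_integers_mult) simp_all
  also have "\<dots> = bernoulli_poly (p - 2) (1 / 3) / 12"
    using chi3_square_eq_1[of "int p"] not_3_dvd_p int_dvd_int_iff[of 3 p]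
    by (simp add: mult.left_commute)
  finally show ?thesis .
qed

end

section \<open>Binomial sums modulo powers of a prime\<close>

context prime_localization
begin

lemma choose_pred_pcong:
  assumes "k < p"
  shows "of_nat (p - 1 choose k) \<equiv>\<^bsub>1\<^esub> (-1) ^ k"
  using assms
proof (induction k)
  case (Suc k)
  have "p dvd (p choose Suc k)"
    using Suc.prems prime_p by (intro dvd_choose_prime) auto
  then have "of_nat (p choose Suc k) \<equiv>\<^bsub>1\<^esub> of_nat 0"
    by (intro pcong_of_nat) (simp add: cong_0_iff)
  moreover have "(p choose Suc k) = (p - 1 choose k) + (p - 1 choose Suc k)"
    using Suc.prems by (cases p) simp_all
  ultimately have "of_nat (p choose Suc k) - of_nat (p - 1 choose k) \<equiv>\<^bsub>1\<^esub> of_nat 0 - (-1) ^ k"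
    using Suc by (intro pcong_diff) simp_all
  then show ?case
    using \<open>(p choose Suc k) = _\<close> by simp
qed simp

lemma choose_pred_product_pcong:
  assumes "0 < k" "k < p"
  shows "(-1) ^ k * of_nat (p - 1 choose (k - 1)) * of_nat (p - 1 choose k)
    \<equiv>\<^bsub>2\<^esub> of_nat (p - 1 choose (k - 1)) - of_nat (p - 1 choose k) + (-1) ^ k"
proof -
  define s c d where "s = ((-1) ^ k :: rat)" and "c = (of_nat (p - 1 choose (k - 1)) :: rat)"
    and "d = (of_nat (p - 1 choose k) :: rat)"
  have "(-1) ^ (k - 1) = - s"
    using assms by (cases k) (simp_all add: s_def)
  then have "c \<equiv>\<^bsub>1\<^esub> - s" "d \<equiv>\<^bsub>1\<^esub> s"
    using assms choose_pred_pcong[of "k - 1"] choose_pred_pcong[of k]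
    by (simp_all add: s_def c_def d_def)
  then have "c + s \<equiv>\<^bsub>1\<^esub> 0" "d - s \<equiv>\<^bsub>1\<^esub> 0"
    by (simp_all add: pcong_def)
  then have "(c + s) * (d - s) \<equiv>\<^bsub>2\<^esub> (c + s) * 0"
    by (rule pcong_mult_raise) simp
  then have "s * ((c + s) * (d - s)) + (c - d + s) \<equiv>\<^bsub>2\<^esub> s * ((c + s) * 0) + (c - d + s)"
    by (intro pcong_add pcong_refl pcong_mult_left[of s]) (simp_all add: s_def)
  moreover have "s * s = 1"
    by (simp add: s_def flip: power_add)
  ultimately have "s * c * d \<equiv>\<^bsub>2\<^esub> c - d + s"
    by (simp add: algebra_simps)
  then show ?thesis
    unfolding s_def c_def d_def .
qed

lemma square_ratio_prod_pcong:
  assumes "j < p"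
  shows "square_ratio_prod p j \<equiv>\<^bsub>4\<^esub> 1 - of_nat p ^ 2 * harmonic 2 j"
proof -
  have "- (of_nat p ^ 2 / of_nat t ^ 2) \<equiv>\<^bsub>2\<^esub> 0" if "t \<in> {1..j}" for t
    using that assms pcong_uminus[OF pcong_power_mult_0[OF p_integers_inverse_power_less[of t]]]
    by fastforce
  from prod_one_plus_pcong[of "{1..j}", OF this] show ?thesis
    by (simp add: square_ratio_prod_def harmonic_def sum_negf sum_distrib_left)
qed

lemma square_ratio_prod_pcong_1:
  assumes "j < p"
  shows "square_ratio_prod p j \<equiv>\<^bsub>2\<^esub> 1"
proof -
  have "square_ratio_prod p j \<equiv>\<^bsub>2\<^esub> 1 - of_nat p ^ 2 * harmonic 2 j"
    using pcong_mono[OF square_ratio_prod_pcong[OF assms]] by simp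
  also have "\<dots> \<equiv>\<^bsub>2\<^esub> 1 - 0"
    using assms by (intro pcong_diff pcong_power_mult_0 p_integers_harmonic) simp_all
  finally show ?thesis
    by simp
qed

lemma not_dvd_add_choose:
  assumes "k < p"
  shows "\<not> p dvd ((p + k) choose k)"
  using assms
proof (induction k)
  case 0
  then show ?case
    using prime_p by (simp add: prime_nat_iff)
next
  case (Suc k)
  show ?case
  proof
    assume "p dvd ((p + Suc k) choose Suc k)"
    then have "p dvd Suc k * ((p + Suc k) choose Suc k)"
      by simp
    also have "Suc k * ((p + Suc k) choose Suc k) = (p + Suc k) * ((p + k) choose k)"
      using Suc_times_binomial[of k "p + k"] by simp
    finally have "p dvd p + Suc k"
      using Suc prime_dvd_multD[OF prime_p] by (metis Suc_lessD)
    then have "p dvd Suc k"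
      by (simp only: dvd_add_triv_left_iff)
    then show False
      using Suc.prems by (auto dest: dvd_imp_le)
  qed
qed

lemma binom_ratio_pcong_0:
  assumes "0 < k" "k < p"
  shows "binom_ratio p k \<equiv>\<^bsub>1\<^esub> 0"
proof -
  have inverse_choose: "1 / of_nat ((p + k) choose k) \<in> p_integers"
    using assms by (intro p_integers_inverse_not_dvd not_dvd_add_choose)
  then have "of_nat p ^ 1 * (1 / of_nat k * of_nat (p - 1 choose (k - 1))
      * (1 / of_nat ((p + k) choose k))) \<equiv>\<^bsub>1\<^esub> 0"
    using assms
    by (intro pcong_power_mult_0 p_integers_mult[OF p_integers_mult inverse_choose]
        p_integers_inverse_less p_integers_of_nat)
  then show ?thesis
    using assms by (simp add: binom_ratio_def choose_eq_div_times_choose_pred)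
qed

lemma binom_ratio_pcong:
  assumes "0 < k" "k < p"
  shows "binom_ratio p k \<equiv>\<^bsub>3\<^esub> (-1) ^ k * of_nat (p choose k) * of_nat (p - 1 choose k)"
proof -
  have Q: "(-1) ^ k * square_ratio_prod p k = of_nat (p - 1 choose k) * of_nat ((p + k) choose k)"
    using square_ratio_prod_Suc_eq_binomials[of k "p - 1"] by simp
  have "binom_ratio p k * square_ratio_prod p k \<equiv>\<^bsub>3\<^esub> binom_ratio p k * 1"
    using assms
    by (intro pcong_mult_raise[OF binom_ratio_pcong_0 square_ratio_prod_pcong_1]) simp_all
  then have "binom_ratio p k \<equiv>\<^bsub>3\<^esub> binom_ratio p k * square_ratio_prod p k"
    by (simp add: pcong_sym)
  also have "square_ratio_prod p k
      = (-1) ^ k * (of_nat (p - 1 choose k) * of_nat ((p + k) choose k))"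
    unfolding Q[symmetric] by simp
  also have "binom_ratio p k * \<dots> = (-1) ^ k * of_nat (p choose k) * of_nat (p - 1 choose k)"
    by (simp add: binom_ratio_def)
  finally show ?thesis .
qed

lemma p_integers_p_div_fact:
  assumes "n < 2 * p"
  shows "of_nat p / fact n \<in> p_integers"
proof (cases "n < p")
  case True
  then have "\<not> p dvd fact n"
    using prime_p by (simp add: prime_dvd_fact_iff)
  then have "of_nat p * (1 / of_nat (fact n)) \<in> p_integers"
    by (intro p_integers_mult p_integers_of_nat p_integers_inverse_not_dvd)
  then show ?thesis
    by simp
next
  case False
  then have "fact n = p * \<Prod>({1..n} - {p})"
    using prod.remove[of "{1..n}" p "\<lambda>k. k"] p_pos by (simp add: fact_prod Suc_leI)
  then have "(fact n :: rat) = of_nat p * of_nat (\<Prod>({1..n} - {p}))"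
    by (metis of_nat_fact of_nat_mult)
  moreover have "\<not> p dvd \<Prod>({1..n} - {p})"
  proof
    assume "p dvd \<Prod>({1..n} - {p})"
    then have "\<exists>k\<in>{1..n} - {p}. p dvd k"
      using prime_p by (simp add: prime_dvd_prod_iff)
    then obtain q where q: "p * q \<in> {1..n} - {p}"
      unfolding dvd_def by blast
    then have "p * q \<le> n"
      by simp
    with assms have "p * q < p * 2"
      by linarith
    then have "q < 2"
      by simp
    with q show False
      by (auto simp: less_2_cases_iff)
  qed
  ultimately show ?thesis
    using p_integers_inverse_not_dvd[of "\<Prod>({1..n} - {p})"] by simp
qed

lemma p_integers_p_times_binom_ratio:
  assumes "k \<le> n" "n < p"
  shows "of_nat p * binom_ratio n k \<in> p_integers"
proof -
  have "of_nat p * binom_ratio n k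
      = of_nat (n choose k) * (of_nat (fact k) * (of_nat (fact n) * (of_nat p / fact (n + k))))"
    using assms by (simp add: binom_ratio_def binomial_fact)
  also have "\<dots> \<in> p_integers"
    using assms by (intro p_integers_mult p_integers_of_nat p_integers_p_div_fact) simp_all
  finally show ?thesis .
qed

lemma p_integers_p_times_chi3_ratio_sum:
  assumes "n < p"
  shows "of_nat p * chi3_ratio_sum n \<in> p_integers"
proof -
  have "of_nat p * chi3_ratio_sum n = (\<Sum>k=1..n. chi3 (int k) * (of_nat p * binom_ratio n k))"
    by (simp add: chi3_ratio_sum_def sum_distrib_left mult.left_commute)
  also have "\<dots> \<in> p_integers"
    using assms by (intro p_integers_sum p_integers_mult p_integers_p_times_binom_ratio) auto
  finally show ?thesis .
qed

lemma sum_chi3_ratio_sum_div_square_pcong: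
  "of_nat p ^ 2 * (\<Sum>i=1..<p. chi3_ratio_sum i / of_nat i ^ 2)
    \<equiv>\<^bsub>3\<^esub> - proper_chi3_ratio_sum p"
proof -
  have "{1..<p} = {1..p - 1}"
    by auto
  then have "of_nat p ^ 2 * (\<Sum>i=1..<p. chi3_ratio_sum i / of_nat i ^ 2)
      = (\<Sum>k=1..<p. chi3 (int k) / of_nat k ^ 2 * (of_nat p ^ 2 * binom_ratio (p - 1) k))"
    by (simp only: sum_chi3_ratio_sum_div_square) (simp add: sum_distrib_left mult_ac)
  also have "\<dots> = (\<Sum>k=1..<p. chi3 (int k) / of_nat k ^ 2
      * ((of_nat p ^ 2 - of_nat k ^ 2) * binom_ratio p k))"
    using binom_ratio_Suc_left[of "p - 1"] by simp
  also have "\<dots> = (\<Sum>k=1..<p. chi3 (int k) * (1 / of_nat k ^ 2) * (of_nat p ^ 2 * binom_ratio p k)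
        - chi3 (int k) * binom_ratio p k)"
    by (intro sum.cong refl) (simp add: field_simps)
  also have "\<dots>
      \<equiv>\<^bsub>3\<^esub> (\<Sum>k=1..<p. chi3 (int k) * (1 / of_nat k ^ 2) * 0 - chi3 (int k) * binom_ratio p k)"
  proof (intro pcong_sum pcong_diff pcong_mult_left pcong_refl p_integers_mult p_integers_chi3)
    fix k assume k: "k \<in> {1..<p}"
    then show "1 / of_nat k ^ 2 \<in> p_integers"
      by (intro p_integers_inverse_power_less) auto
    have "of_nat p ^ 2 * binom_ratio p k \<equiv>\<^bsub>3\<^esub> of_nat p ^ 2 * 0"
      using k by (intro pcong_power_mult_left[OF binom_ratio_pcong_0]) auto
    then show "of_nat p ^ 2 * binom_ratio p k \<equiv>\<^bsub>3\<^esub> 0"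
      by simp
  qed
  finally show ?thesis
    by (simp add: proper_chi3_ratio_sum_def sum_negf)
qed

lemma apery_weight_times_chi3_ratio_sum_pcong:
  assumes "0 < i" "i < p"
  shows "apery_weight p i * chi3_ratio_sum i
    \<equiv>\<^bsub>3\<^esub> 3 * (of_nat p ^ 2 * (chi3_ratio_sum i / of_nat i ^ 2))"
proof -
  have inverse_square: "1 / of_nat i ^ 2 \<in> p_integers"
    using assms by (rule p_integers_inverse_power_less)
  define a where "a = of_nat p ^ 1 * (of_nat p * chi3_ratio_sum i * (1 / of_nat i ^ 2))"
  have "a \<equiv>\<^bsub>1\<^esub> 0"
    unfolding a_def using assms inverse_square
    by (intro pcong_power_mult_0 p_integers_mult p_integers_p_times_chi3_ratio_sum)
  have square_ratio_prod: "square_ratio_prod p (i - 1) \<equiv>\<^bsub>2\<^esub> 1"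
    using assms by (intro square_ratio_prod_pcong_1) simp
  have "of_nat p ^ 2 * (1 / of_nat i ^ 2) \<equiv>\<^bsub>2\<^esub> 0"
    using inverse_square by (intro pcong_power_mult_0)
  then have "3 - of_nat p ^ 2 * (1 / of_nat i ^ 2) \<equiv>\<^bsub>2\<^esub> 3 - 0"
    by (intro pcong_diff pcong_refl)
  then have "(3 - of_nat p ^ 2 * (1 / of_nat i ^ 2)) * square_ratio_prod p (i - 1) ^ 2
      \<equiv>\<^bsub>2\<^esub> (3 - 0) * 1 ^ 2"
    using inverse_square square_ratio_prod
    by (intro pcong_mult pcong_power p_integers_diff p_integers_mult)
      (auto intro: pcong_p_integers)
  then have "a * ((3 - of_nat p ^ 2 * (1 / of_nat i ^ 2)) * square_ratio_prod p (i - 1) ^ 2)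
      \<equiv>\<^bsub>3\<^esub> a * ((3 - 0) * 1 ^ 2)"
    by (intro pcong_mult_raise[OF \<open>a \<equiv>\<^bsub>1\<^esub> 0\<close>]) simp_all
  then show ?thesis
    by (simp add: a_def apery_weight_def power2_eq_square mult_ac)
qed

end

context odd_prime_localization
begin

lemma alternating_chi3_sum_1_pcong:
  "alternating_chi3_sum 1 p \<equiv>\<^bsub>2\<^esub> of_nat p * alternating_chi3_sum 2 p"
proof -
  have "alternating_chi3_sum 1 p = (\<Sum>k=1..<p. of_nat (p choose k) * chi3 (int k) / of_nat k)"
    by (rule sum_choose_chi3_div_odd[OF odd_p, symmetric])
  also have "\<dots> = of_nat p ^ 1
      * (\<Sum>k=1..<p. chi3 (int k) * (1 / of_nat k ^ 2) * of_nat (p - 1 choose (k - 1)))"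
    unfolding sum_distrib_left
    by (intro sum.cong refl) (simp add: choose_eq_div_times_choose_pred power2_eq_square)
  also have "\<dots>
      \<equiv>\<^bsub>2\<^esub> of_nat p ^ 1 * (\<Sum>k=1..<p. chi3 (int k) * (1 / of_nat k ^ 2) * (-1) ^ (k - 1))"
    by (intro pcong_power_mult_left[where n = 1] pcong_sum pcong_mult_left choose_pred_pcong
        p_integers_mult p_integers_chi3 p_integers_inverse_power_less) auto
  also have "(\<Sum>k=1..<p. chi3 (int k) * (1 / of_nat k ^ 2) * (-1) ^ (k - 1))
      = alternating_chi3_sum 2 p"
    unfolding alternating_chi3_sum_def
    by (intro sum.cong refl) (auto simp: Suc_le_eq gr0_conv_Suc)
  finally show ?thesis
    by simp
qed

lemma proper_chi3_ratio_sum_pcong: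
  "proper_chi3_ratio_sum p \<equiv>\<^bsub>3\<^esub> - 2 * (of_nat p * alternating_chi3_sum 1 p)"
proof -
  define c where "c k = (of_nat (p - 1 choose k) :: rat)" for k
  have "chi3 (int k) * binom_ratio p k
      \<equiv>\<^bsub>3\<^esub> of_nat p ^ 1 * (chi3 (int k) * (1 / of_nat k) * (c (k - 1) - c k + (-1) ^ k))"
    if "k \<in> {1..<p}" for k
  proof -
    have "chi3 (int k) * binom_ratio p k \<equiv>\<^bsub>3\<^esub> chi3 (int k) * ((-1) ^ k * of_nat (p choose k) * c k)"
      using that unfolding c_def by (intro pcong_mult_left p_integers_chi3 binom_ratio_pcong) auto
    also have "\<dots> = of_nat p ^ 1 * (chi3 (int k) * (1 / of_nat k) * ((-1) ^ k * c (k - 1) * c k))"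
      using that by (simp add: choose_eq_div_times_choose_pred c_def)
    also have "\<dots> \<equiv>\<^bsub>3\<^esub> of_nat p ^ 1 * (chi3 (int k) * (1 / of_nat k) * (c (k - 1) - c k + (-1) ^ k))"
      unfolding c_def using that
      by (intro pcong_power_mult_left[where n = 2] pcong_mult_left choose_pred_product_pcong
          p_integers_mult p_integers_chi3 p_integers_inverse_less) auto
    finally show ?thesis .
  qed
  then have "proper_chi3_ratio_sum p
      \<equiv>\<^bsub>3\<^esub> (\<Sum>k=1..<p. of_nat p ^ 1
          * (chi3 (int k) * (1 / of_nat k) * (c (k - 1) - c k + (-1) ^ k)))"
    unfolding proper_chi3_ratio_sum_def by (rule pcong_sum)
  also have "\<dots> = (\<Sum>k=1..<p. of_nat (p choose k) * chi3 (int k)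
      - of_nat p * (c k * chi3 (int k) / of_nat k)
      - of_nat p * ((-1) ^ Suc k * chi3 (int k) / of_nat k))"
    by (intro sum.cong refl) (simp add: choose_eq_div_times_choose_pred c_def
        add_divide_distrib diff_divide_distrib algebra_simps)
  also have "\<dots> = - 2 * (of_nat p * alternating_chi3_sum 1 p)"
    by (simp only: sum_subtractf sum_distrib_left[symmetric] c_def
        sum_choose_chi3_eq_0[OF odd_p] sum_choose_pred_chi3_div[OF p_pos])
      (simp add: alternating_chi3_sum_def)
  finally show ?thesis .
qed

end

context prime_gt_3_localization
begin

lemma square_ratio_prod_pred_pcong_1: "square_ratio_prod p (p - 1) \<equiv>\<^bsub>3\<^esub> 1"
proof -
  have "square_ratio_prod p (p - 1) \<equiv>\<^bsub>3\<^esub> 1 - of_nat p ^ 2 * harmonic 2 (p - 1)"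
    using pcong_mono[OF square_ratio_prod_pcong[of "p - 1"]] by simp
  also have "\<dots> \<equiv>\<^bsub>3\<^esub> 1 - of_nat p ^ 2 * 0"
    using p_gt_4
    by (intro pcong_diff pcong_refl pcong_power_mult_left[OF harmonic_full_pcong_0]) simp_all
  finally show ?thesis
    by simp
qed

lemma proper_chi3_ratio_sum_pcong_bernoulli_poly:
  "proper_chi3_ratio_sum p
    \<equiv>\<^bsub>3\<^esub> - (of_nat p ^ 2 / 6 * bernoulli_poly (p - 2) (1 / 3))"
proof -
  have "of_nat p ^ 1 * alternating_chi3_sum 1 p
      \<equiv>\<^bsub>3\<^esub> of_nat p ^ 1 * (of_nat p * alternating_chi3_sum 2 p)"
    by (rule pcong_power_mult_left[OF alternating_chi3_sum_1_pcong]) simp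
  also have "\<dots> = of_nat p ^ 2 * alternating_chi3_sum 2 p"
    by (simp add: power2_eq_square)
  also have "\<dots> \<equiv>\<^bsub>3\<^esub> of_nat p ^ 2 * (bernoulli_poly (p - 2) (1 / 3) / 12)"
    by (rule pcong_power_mult_left[OF alternating_chi3_sum_2_pcong]) simp
  finally have "- 2 * (of_nat p * alternating_chi3_sum 1 p)
      \<equiv>\<^bsub>3\<^esub> - 2 * (of_nat p ^ 2 * (bernoulli_poly (p - 2) (1 / 3) / 12))"
    by (intro pcong_mult_left) auto
  with proper_chi3_ratio_sum_pcong show ?thesis
    by (auto intro: pcong_trans)
qed

lemma apery_sum_pcong_proper_chi3_ratio_sum:
  "(1 / of_nat p) * (\<Sum>k<p. (-1) ^ k * of_nat (2 * k + 1) * of_nat (apery k))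
    \<equiv>\<^bsub>3\<^esub> chi3 (int p) - proper_chi3_ratio_sum p"
proof -
  define Q Y where "Q = square_ratio_prod p (p - 1)" and "Y = proper_chi3_ratio_sum p"
  have "Q \<equiv>\<^bsub>3\<^esub> 1"
    unfolding Q_def by (rule square_ratio_prod_pred_pcong_1)
  have "central_binom_sum p \<in> p_integers"
    unfolding central_binom_sum_def central_binom_def by (intro p_integers_sum p_integers_of_nat)
  have "Y \<in> p_integers"
    unfolding Y_def proper_chi3_ratio_sum_def
    by (intro p_integers_sum p_integers_mult p_integers_chi3
        pcong_p_integers[OF binom_ratio_pcong_0]) auto
  have central_binom_sum: "central_binom_sum p = chi3 (int p) + Y * (2 * Q)"
    using central_binom_sum_eq_proper_chi3_ratio_sum[OF p_pos]
      central_binom_eq_square_ratio_prod[of "p - 1"] odd_p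
    by (simp add: Q_def Y_def mult.commute)
  have "(1 / of_nat p) * (\<Sum>k<p. (-1) ^ k * of_nat (2 * k + 1) * of_nat (apery k))
      = central_binom_sum p * Q + (\<Sum>i=1..<p. apery_weight p i * chi3_ratio_sum i)"
    unfolding alternating_apery_sum[OF p_pos]
    using odd_p by (simp add: Q_def central_binom_sum_eq_chi3_ratio_sum mult.commute)
  also have "\<dots> \<equiv>\<^bsub>3\<^esub> central_binom_sum p * 1
      + (\<Sum>i=1..<p. 3 * (of_nat p ^ 2 * (chi3_ratio_sum i / of_nat i ^ 2)))"
    using \<open>Q \<equiv>\<^bsub>3\<^esub> 1\<close> \<open>central_binom_sum p \<in> p_integers\<close>
    by (intro pcong_add pcong_mult_left[of "central_binom_sum p"] pcong_sum
        apery_weight_times_chi3_ratio_sum_pcong) simp_all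
  also have "\<dots> = chi3 (int p) + Y * (2 * Q)
      + 3 * (of_nat p ^ 2 * (\<Sum>i=1..<p. chi3_ratio_sum i / of_nat i ^ 2))"
    by (simp only: central_binom_sum sum_distrib_left mult_1_right)
  also have "\<dots> \<equiv>\<^bsub>3\<^esub> chi3 (int p) + Y * (2 * 1) + 3 * - Y"
    unfolding Y_def
    using \<open>Q \<equiv>\<^bsub>3\<^esub> 1\<close> \<open>Y \<in> p_integers\<close>[unfolded Y_def]
    by (intro pcong_add pcong_refl pcong_mult_left sum_chi3_ratio_sum_div_square_pcong) simp_all
  finally show ?thesis
    by (simp add: Y_def)
qed

end

theorem theorem1p1:
  fixes p :: nat
  assumes "prime p" and "p > 3"
  shows "rat_cong
           ((1 / of_nat p) * (\<Sum>k<p. (-1)^k * of_nat (2 * k + 1) * of_nat (apery k)))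
           (of_int (Legendre (int p) 3)
              + (of_nat p)^2 / 6 * bernoulli_poly (p - 2) (1 / 3))
           (int p) 3"
proof -
  interpret prime_gt_3_localization p
    using assms by unfold_locales
  have "(1 / of_nat p) * (\<Sum>k<p. (-1)^k * of_nat (2 * k + 1) * of_nat (apery k))
      \<equiv>\<^bsub>3\<^esub> chi3 (int p) - proper_chi3_ratio_sum p"
    by (rule apery_sum_pcong_proper_chi3_ratio_sum)
  also have "\<dots> \<equiv>\<^bsub>3\<^esub> chi3 (int p) - - (of_nat p ^ 2 / 6 * bernoulli_poly (p - 2) (1 / 3))"
    by (intro pcong_diff pcong_refl proper_chi3_ratio_sum_pcong_bernoulli_poly)
  finally show ?thesis
    by (simp add: rat_cong_iff_pcong chi3_def)
qed

end
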